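(* Let $\mathrm{K}_V^{\mathbf t}$ be a complete $\mathbf t$-spread $d$-partite hypergraph with $|V(\mathrm{K}_V^{\mathbf t})|=r$, and let $S$ be the ambient ring of $I(\mathrm{K}_V^{\mathbf t})$. Then $$\lim_{k\to\infty}\mathrm{depth}\big(S/I(\mathrm{K}_V^{\mathbf t})^k\big)=d-1,$$ and $\mathrm{dstab}(I(\mathrm{K}_V^{\mathbf t}))\le r-d$.
   Context: Setting. Let $n,d\ge 1$ be integers, $[n]=\{1,\dots,n\}$, and let $\mathbf t=(t_1,\dots,t_{d-1})$ be a vector of integers with $t_i\ge 1$ for all $i$. Let $V=\{V_1,\dots,V_d\}$ be a family of nonempty, pairwise disjoint subsets of $[n]$ such that $p<q$ whenever $p\in V_i$, $q\in V_j$ and $i<j$. A $\mathbf t$-spread edge is a set $\{k_1,\dots,k_d\}$ with $k_j\in V_j$ for $j=1,\dots,d$ and $k_j-k_{j-1}\ge t_{j-1}$ for $j=2,\dots,d$. The complete $\mathbf t$-spread $d$-partite hypergraph $\mathrm{K}_V^{\mathbf t}$ is the hypergraph with vertex set $V(\mathrm{K}_V^{\mathbf t})=V_1\cup\dots\cup V_d$ whose edges are all the $\mathbf t$-spread edges. Standing assumption: $\mathrm{K}_V^{\mathbf t}$ has no isolated vertices, i.e. every vertex belongs to at least one edge. Let $\mathbb{K}$ be a field. The ambient ring is $S=\mathbb{K}[x_i : i\in V(\mathrm{K}_V^{\mathbf t})]$. The edge ideal $I(\mathrm{K}_V^{\mathbf t})\subset S$ is the ideal generated by the monomials $x_{k_1}\cdots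 x_{k_d}$, where $\{k_1,\dots,k_d\}$ runs over the edges of $\mathrm{K}_V^{\mathbf t}$. For a graded ideal $I\subset S$, $\mathrm{depth}\,S/I^k$ is constant for all large $k$ (Brodmann); this constant is $\lim_{k\to\infty}\mathrm{depth}\,S/I^k$. The index of depth stability $\mathrm{dstab}(I)$ is the minimum value of $k$ for which $\mathrm{depth}\,S/I^k=\mathrm{depth}\,S/I^{k+t}$ for all $t>0$.
   Formalization: The bound dstab(I) ≤ r−d is stated only for d < r: if r = d, every V_i is a singleton, I is principal, depth S/I^k = d−1 for all k ≥ 1, so dstab(I) = 1 > 0 = r−d and the printed bound fails; the limit is stated for all r. *)

theory Defs
  imports
    "HOL-Algebra.Module"
    "HOL-Algebra.QuotRing"
    "HOL-Algebra.Ideal_Product"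
    "HOL-Library.Poly_Mapping"
    "HOL-Library.Extended_Real"
    "HOL-Library.Disjoint_Sets"
begin

section \<open>Polynomial rings in finitely many variables\<close>

text \<open>An exponent vector is a finitely supported function from variable indices to naturals; a
  polynomial is a finitely supported function from exponent vectors to coefficients. The ring
  \<open>mpoly_ring X\<close> has only the variables indexed by \<open>X\<close>.\<close>

type_synonym 'k mpoly = "(nat \<Rightarrow>\<^sub>0 nat) \<Rightarrow>\<^sub>0 'k"

definition Var :: "nat \<Rightarrow> 'k::comm_ring_1 mpoly"
  where "Var i = Poly_Mapping.single (Poly_Mapping.single i 1) 1"

definition mpoly_ring :: "nat set \<Rightarrow> 'k::comm_ring_1 mpoly ring"
  where "mpoly_ring X =
    \<lparr>carrier = {p. \<forall>m\<in>Poly_Mapping.keys p. Poly_Mapping.keys m \<subseteq> X},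
     mult = (*), one = 1, zero = 0, add = (+)\<rparr>"

lemma cring_mpoly_ring: "cring (mpoly_ring X :: 'k::comm_ring_1 mpoly ring)"
proof -
  let ?C = "carrier (mpoly_ring X :: 'k mpoly ring)"
  have C: "p \<in> ?C \<longleftrightarrow> (\<forall>m\<in>Poly_Mapping.keys p. Poly_Mapping.keys m \<subseteq> X)" for p
    by (simp add: mpoly_ring_def)
  have add: "p + q \<in> ?C" if "p \<in> ?C" "q \<in> ?C" for p q
    using that Poly_Mapping.keys_add[of p q] unfolding C by blast
  have neg: "- p \<in> ?C" if "p \<in> ?C" for p
    using that by (simp add: C in_keys_iff)
  have mult: "p * q \<in> ?C" if "p \<in> ?C" "q \<in> ?C" for p q
    unfolding C
  proof
    fix m assume "m \<in> Poly_Mapping.keys (p * q)"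
    then obtain a b where "a \<in> Poly_Mapping.keys p" "b \<in> Poly_Mapping.keys q" "m = a + b"
      using Poly_Mapping.keys_mult[of p q] by blast
    then show "Poly_Mapping.keys m \<subseteq> X"
      using that Poly_Mapping.keys_add[of a b] unfolding C by blast
  qed
  have zero: "0 \<in> ?C" and one: "1 \<in> ?C"
    by (simp_all add: C)
  have ops: "mult (mpoly_ring X :: 'k mpoly ring) = (*)" "add (mpoly_ring X :: 'k mpoly ring) = (+)"
    "one (mpoly_ring X :: 'k mpoly ring) = 1" "zero (mpoly_ring X :: 'k mpoly ring) = 0"
    by (simp_all add: mpoly_ring_def)
  show ?thesis
  proof (rule cringI)
    show "abelian_group (mpoly_ring X :: 'k mpoly ring)"
    proof (rule abelian_groupI, unfold ops)
      fix p q r :: "'k mpoly"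
      show "p + q \<in> ?C" if "p \<in> ?C" "q \<in> ?C" using that by (rule add)
      show "0 \<in> ?C" by (rule zero)
      show "p + q + r = p + (q + r)" by (rule add.assoc)
      show "p + q = q + p" by (rule add.commute)
      show "0 + p = p" by (rule add_0_left)
      show "\<exists>y\<in>?C. y + p = 0" if "p \<in> ?C"
        using neg[OF that] left_minus[of p] by blast
    qed
    show "Group.comm_monoid (mpoly_ring X :: 'k mpoly ring)"
    proof (rule comm_monoidI, unfold ops)
      fix p q r :: "'k mpoly"
      show "p * q \<in> ?C" if "p \<in> ?C" "q \<in> ?C" using that by (rule mult)
      show "1 \<in> ?C" by (rule one)
      show "p * q * r = p * (q * r)" by (rule mult.assoc)
      show "p * q = q * p" by (rule mult.commute)
      show "1 * p = p" by (rule mult_1_left)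
    qed
  qed (unfold ops, rule distrib_right)
qed

definition irrelevant_ideal :: "nat set \<Rightarrow> 'k::comm_ring_1 mpoly set"
  where "irrelevant_ideal X = genideal (mpoly_ring X) (Var ` X)"


section \<open>Regular sequences and depth\<close>

definition quot_module :: "('a, 'b) ring_scheme \<Rightarrow> 'a set \<Rightarrow> ('a, 'a set) module"
  where "quot_module R J =
    \<lparr>carrier = carrier (R Quot J), mult = mult (R Quot J), one = one (R Quot J),
     zero = zero (R Quot J), add = add (R Quot J),
     smult = (\<lambda>a x. (J +>\<^bsub>R\<^esub> a) \<otimes>\<^bsub>R Quot J\<^esub> x)\<rparr>"

lemma module_quot_module:
  assumes "cring R" "ideal J R"
  shows "Module.module R (quot_module R J)"
proof -
  interpret R: cring R by fact
  interpret J: ideal J R by fact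
  interpret Q: cring "R Quot J" by (rule J.quotient_is_cring) (rule assms(1))
  interpret h: ring_hom_ring R "R Quot J" "(+>\<^bsub>R\<^esub>) J" by (rule J.rcos_ring_hom_ring)
  have car: "carrier (quot_module R J) = carrier (R Quot J)"
    and ad: "add (quot_module R J) = add (R Quot J)"
    and ze: "zero (quot_module R J) = zero (R Quot J)"
    and sm: "smult (quot_module R J) = (\<lambda>a x. (J +>\<^bsub>R\<^esub> a) \<otimes>\<^bsub>R Quot J\<^esub> x)"
    by (simp_all add: quot_module_def)
  have "abelian_group (quot_module R J)"
  proof (rule abelian_groupI)
    fix x assume "x \<in> carrier (quot_module R J)"
    then show "\<exists>y\<in>carrier (quot_module R J). y \<oplus>\<^bsub>quot_module R J\<^esub> x = \<zero>\<^bsub>quot_module R J\<^esub>"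
      unfolding car ad ze by (meson Q.a_inv_closed Q.l_neg)
  qed (simp_all only: car ad ze Q.a_closed Q.zero_closed Q.l_zero Q.a_assoc, rule Q.a_comm)
  moreover have "(J +>\<^bsub>R\<^esub> a) \<in> carrier (R Quot J)" if "a \<in> carrier R" for a
    using that by (rule h.hom_closed)
  ultimately show ?thesis
    by (intro moduleI[OF assms(1)])
      (simp_all only: car ad sm Q.l_distr Q.r_distr Q.m_assoc Q.m_closed Q.l_one
        h.hom_add h.hom_mult h.hom_one)
qed

text \<open>The submodule \<open>A M\<close> generated by all products \<open>a x\<close> with \<open>a \<in> A\<close> and \<open>x \<in> M\<close>.\<close>

definition mult_submodule :: "('a, 'b) ring_scheme \<Rightarrow> ('a, 'c, 'd) module_scheme \<Rightarrow> 'a set \<Rightarrow> 'c set"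
  where "mult_submodule R M A =
    \<Inter>{N. submodule N R M \<and> (\<forall>a\<in>A. \<forall>x\<in>carrier M. a \<odot>\<^bsub>M\<^esub> x \<in> N)}"

text \<open>The middle condition says that each \<open>x\<^sub>i\<close> is a nonzerodivisor on
  \<open>M / (x\<^sub>1, \<dots>, x\<^sub>i\<^sub>-\<^sub>1) M\<close>.\<close>

definition regular_sequence ::
    "('a, 'b) ring_scheme \<Rightarrow> ('a, 'c, 'd) module_scheme \<Rightarrow> 'a list \<Rightarrow> bool"
  where "regular_sequence R M xs \<longleftrightarrow>
    set xs \<subseteq> carrier R \<and>
    (\<forall>i<length xs. \<forall>y\<in>carrier M.
       xs ! i \<odot>\<^bsub>M\<^esub> y \<in> mult_submodule R M (set (take i xs)) \<longrightarrow>
       y \<in> mult_submodule R M (set (take i xs))) \<and>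
    mult_submodule R M (set xs) \<noteq> carrier M"

text \<open>For a graded module over a polynomial ring, the depth is taken with respect to the graded
  maximal ideal. The supremum is taken in \<^typ>\<open>enat\<close>, so that it is meaningful without knowing
  beforehand that the lengths are bounded.\<close>

definition depth ::
    "('a, 'b) ring_scheme \<Rightarrow> 'a set \<Rightarrow> ('a, 'c, 'd) module_scheme \<Rightarrow> enat"
  where "depth R \<mm> M = (SUP xs\<in>{xs. set xs \<subseteq> \<mm> \<and> regular_sequence R M xs}. enat (length xs))"

text \<open>The sequence \<open>k \<mapsto> depth (R / I\<^sup>k)\<close>; powers of ideals are taken in the
  multiplicative monoid of ideals.\<close>

definition depth_power :: "('a, 'b) ring_scheme \<Rightarrow> 'a set \<Rightarrow> 'a set \<Rightarrow> nat \<Rightarrow> enat"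
  where "depth_power R \<mm> I k = depth R \<mm> (quot_module R (I [^]\<^bsub>ideals_set R\<^esub> k))"

text \<open>The index \<open>k\<close> ranges over positive integers: \<open>R / I\<^sup>0\<close> is the zero module.\<close>

definition dstab :: "('a, 'b) ring_scheme \<Rightarrow> 'a set \<Rightarrow> 'a set \<Rightarrow> nat"
  where "dstab R \<mm> I =
    (LEAST k. k \<ge> 1 \<and> (\<forall>t>0. depth_power R \<mm> I k = depth_power R \<mm> I (k + t)))"


section \<open>Complete t-spread d-partite hypergraphs\<close>

text \<open>The families \<open>V\<^sub>1, \<dots>, V\<^sub>d\<close> and \<open>t\<^sub>1, \<dots>, t\<^sub>d\<^sub>-\<^sub>1\<close> are functions on \<^typ>\<open>nat\<close> of which only
  the values at the indices \<open>1, \<dots>, d\<close> and \<open>1, \<dots>, d - 1\<close> matter.\<close>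

definition spread_vertices :: "nat \<Rightarrow> (nat \<Rightarrow> nat set) \<Rightarrow> nat set"
  where "spread_vertices d V = (\<Union>i\<in>{1..d}. V i)"

definition spread_edges :: "nat \<Rightarrow> (nat \<Rightarrow> int) \<Rightarrow> (nat \<Rightarrow> nat set) \<Rightarrow> nat set set"
  where "spread_edges d t V =
    {k ` {1..d} | k. (\<forall>j\<in>{1..d}. k j \<in> V j) \<and>
                     (\<forall>j\<in>{2..d}. int (k j) - int (k (j - 1)) \<ge> t (j - 1))}"

definition complete_spread_hypergraph ::
    "nat \<Rightarrow> nat \<Rightarrow> (nat \<Rightarrow> int) \<Rightarrow> (nat \<Rightarrow> nat set) \<Rightarrow> bool"
  where "complete_spread_hypergraph n d t V \<longleftrightarrow>
    n \<ge> 1 \<and> d \<ge> 1 \<and>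
    (\<forall>i\<in>{1..d-1}. t i \<ge> 1) \<and>
    (\<forall>i\<in>{1..d}. V i \<noteq> {} \<and> V i \<subseteq> {1..n}) \<and>
    disjoint_family_on V {1..d} \<and>
    (\<forall>i\<in>{1..d}. \<forall>j\<in>{1..d}. i < j \<longrightarrow> (\<forall>p\<in>V i. \<forall>q\<in>V j. p < q)) \<and>
    (\<forall>v\<in>spread_vertices d V. \<exists>e\<in>spread_edges d t V. v \<in> e)"

definition edge_ideal :: "nat set \<Rightarrow> nat set set \<Rightarrow> 'k::comm_ring_1 mpoly set"
  where "edge_ideal X E = genideal (mpoly_ring X) ((\<lambda>e. \<Prod>i\<in>e. Var i) ` E)"

end

theory Submission
  imports Defs "HOL-Library.Product_Lexorder"
begin

text \<open>Write \<open>I\<close> for the edge ideal, \<open>X\<close> for the set of vertices and \<open>r\<close> for their number. The depth of \<open>S / I\<^sup>k\<close>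
  is shown to be exactly \<open>d - 1\<close> for all \<open>k \<ge> 1\<close> with \<open>k \<ge> r - d\<close>, by means of an explicit regular
  sequence of that length. For \<open>l = 1, \<dots>, d - 1\<close> let \<open>a\<^sub>l\<close> be the largest vertex of \<open>V\<^sub>l\<close> and \<open>b\<^sub>l\<close> the
  smallest vertex of \<open>V\<^sub>l\<^sub>+\<^sub>1\<close>, and let \<open>f\<^sub>l = x(a\<^sub>l) - x(b\<^sub>l)\<close>. Dividing by \<open>f\<^sub>l\<close> means to identify the two
  variables, so the ideal generated by \<open>I\<^sup>k\<close> and \<open>f\<^sub>1, \<dots>, f\<^sub>j\<close> is the preimage of a monomial ideal in
  fewer variables (\<open>genideal_connecting_differences\<close>).

  The sequence \<open>f\<^sub>1, \<dots>, f\<^sub>d\<^sub>-\<^sub>1\<close> is regular on \<open>S / I\<^sup>k\<close> for every \<open>k \<ge> 1\<close>. A difference of two variables is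
  a nonzerodivisor modulo a monomial ideal if no monomial outside the ideal is moved into it both by a
  power of the one variable and by a power of the other (\<open>Var_diff_nonzerodivisor\<close>). For the
  ideals at hand this is a property of products of \<open>k\<close> edges. Such a product can be written as a
  tableau with sorted columns, and two tableaux can be combined to a third by taking minima in the
  first blocks and maxima in the others (\<open>merged_multiples_separated\<close>).

  The sequence cannot be extended if \<open>k \<ge> r - d\<close>: there is a monomial of degree \<open>d k - 1\<close> whose product
  with each variable lies in the ideal generated by \<open>I\<^sup>k\<close> and the \<open>f\<^sub>l\<close> (\<open>socle_monomial\<close>). By its degree
  it does not lie in the ideal itself. It is obtained by walking through all vertices in
  increasing order; a step within a block exchanges neighbouring vertices in an edge and uses up one
  factor of \<open>I\<close>, a step between blocks is an identification. There are \<open>r - d\<close> steps of the first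
  kind.

  That one regular sequence with a socle element in its quotient bounds the length of all regular
  sequences is the invariance of depth. It is proved with the Koszul complex on the variables
  (\<open>regular_chain_length_le\<close>): dividing by a nonzerodivisor in the irrelevant ideal shifts the first
  nonvanishing cohomology down by one degree, and in degree 0 the cohomology is the socle.\<close>

section \<open>The Koszul complex and the length of regular sequences\<close>

definition koszul_sign :: "nat \<Rightarrow> nat set \<Rightarrow> 'a::comm_ring_1"
  where "koszul_sign j T = (if even (card {i \<in> T. i < j}) then 1 else - 1)"

text \<open>A Koszul cochain assigns a ring element to each finite set of variables. Cochains are total
  functions; in degree \<open>n\<close> only the values on sets with \<open>n\<close> elements count, and each statement
  below names the sets that it concerns.\<close>

definition koszul_d :: "(nat \<Rightarrow> 'a::comm_ring_1) \<Rightarrow> (nat set \<Rightarrow> 'a) \<Rightarrow> nat set \<Rightarrow> 'a"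
  where "koszul_d x c T = (\<Sum>j\<in>T. koszul_sign j T * x j * c (T - {j}))"

definition koszul_contraction :: "nat \<Rightarrow> (nat set \<Rightarrow> 'a::comm_ring_1) \<Rightarrow> nat set \<Rightarrow> 'a"
  where "koszul_contraction j c T =
    (if j \<in> T then 0 else koszul_sign j (insert j T) * c (insert j T))"

lemma koszul_sign_remove_greater:
  "\<not> i < j \<Longrightarrow> koszul_sign j (T - {i}) = koszul_sign j T"
proof -
  assume "\<not> i < j"
  then have "{t \<in> T - {i}. t < j} = {t \<in> T. t < j}" by auto
  then show ?thesis by (simp add: koszul_sign_def)
qed

lemma koszul_sign_remove_less:
  assumes "finite T" "i \<in> T" "i < j"
  shows "koszul_sign j (T - {i}) = - koszul_sign j T"
proof -
  have "{t \<in> T. t < j} = insert i {t \<in> T - {i}. t < j}" using assms by auto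
  moreover have "finite {t \<in> T - {i}. t < j}" "i \<notin> {t \<in> T - {i}. t < j}" using assms by auto
  ultimately have "card {t \<in> T. t < j} = Suc (card {t \<in> T - {i}. t < j})" by simp
  then show ?thesis by (simp add: koszul_sign_def)
qed

lemma koszul_sign_square [simp]: "koszul_sign j T * koszul_sign j T = 1"
  by (simp add: koszul_sign_def)

lemma koszul_sign_singleton [simp]: "koszul_sign v {v} = 1"
proof -
  have "{i \<in> {v}. i < v} = {}" by auto
  then show ?thesis unfolding koszul_sign_def by (simp only: card.empty) simp
qed

lemma koszul_sign_swap:
  assumes "finite T" "i \<in> T" "j \<in> T" "i \<noteq> j"
  shows "koszul_sign j T * koszul_sign i (T - {j}) = - (koszul_sign i T * koszul_sign j (T - {i}))"
proof (cases "i < j")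
  case True
  then show ?thesis
    using assms by (simp add: koszul_sign_remove_less koszul_sign_remove_greater)
next
  case False
  then have "j < i" using assms by simp
  then show ?thesis
    using assms by (simp add: koszul_sign_remove_less koszul_sign_remove_greater)
qed

lemma koszul_sign_both:
  assumes "finite T" "i \<in> T" "j \<in> T" "i \<noteq> j"
  shows "koszul_sign i (T - {j}) * koszul_sign j (T - {i}) = - (koszul_sign i T * koszul_sign j T)"
proof (cases "i < j")
  case True
  then show ?thesis
    using assms by (simp add: koszul_sign_remove_less koszul_sign_remove_greater)
next
  case False
  then have "j < i" using assms by simp
  then show ?thesis
    using assms by (simp add: koszul_sign_remove_less koszul_sign_remove_greater)
qed

text \<open>The terms for \<open>(i, j)\<close> and \<open>(j, i)\<close> are matched individually: that the sum equals its own
  negative would not suffice in characteristic 2.\<close>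

lemma sum_antisymmetric_eq_0:
  fixes F :: "nat \<Rightarrow> nat \<Rightarrow> 'a::ab_group_add"
  assumes "finite T" "\<And>i j. i \<in> T \<Longrightarrow> j \<in> T \<Longrightarrow> i \<noteq> j \<Longrightarrow> F j i = - F i j"
  shows "(\<Sum>j\<in>T. \<Sum>i\<in>T - {j}. F j i) = 0"
proof -
  have "(\<Sum>i\<in>T - {j}. F j i) = (\<Sum>i\<in>{i \<in> T. i < j}. F j i) + (\<Sum>i\<in>{i \<in> T. j < i}. F j i)" for j
    using assms(1) by (subst sum.union_disjoint[symmetric]) (auto intro: sum.cong)
  then have "(\<Sum>j\<in>T. \<Sum>i\<in>T - {j}. F j i)
      = (\<Sum>j\<in>T. \<Sum>i\<in>{i \<in> T. i < j}. F j i) + (\<Sum>j\<in>T. \<Sum>i\<in>{i \<in> T. j < i}. F j i)"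
    by (simp add: sum.distrib)
  also have "(\<Sum>j\<in>T. \<Sum>i\<in>{i \<in> T. j < i}. F j i) = (\<Sum>i\<in>T. \<Sum>j\<in>{j \<in> T. j < i}. F j i)"
    using assms(1) by (rule sum.swap_restrict[OF _ assms(1)])
  also have "\<dots> = (\<Sum>i\<in>T. \<Sum>j\<in>{j \<in> T. j < i}. - F i j)"
    by (intro sum.cong refl assms(2)) auto
  finally show ?thesis by (simp add: sum_negf)
qed

lemma koszul_d_d:
  fixes x :: "nat \<Rightarrow> 'a::comm_ring_1"
  assumes "finite T"
  shows "koszul_d x (koszul_d x c) T = 0"
proof -
  define F where "F j i = koszul_sign j T * koszul_sign i (T - {j}) * (x j * x i * c (T - {j} - {i}))"
    for j i
  have "koszul_d x (koszul_d x c) T = (\<Sum>j\<in>T. \<Sum>i\<in>T - {j}. F j i)"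
    by (simp add: koszul_d_def F_def sum_distrib_left mult.assoc mult.left_commute)
  also have "\<dots> = 0"
  proof (rule sum_antisymmetric_eq_0[OF assms])
    fix i j assume "i \<in> T" "j \<in> T" "i \<noteq> j"
    moreover have "T - {j} - {i} = T - {i} - {j}" by auto
    ultimately show "F j i = - F i j"
      using koszul_sign_swap[OF assms, of i j, where 'a = 'a]
      by (simp add: F_def mult.left_commute[of "x i"])
  qed
  finally show ?thesis .
qed

text \<open>Contraction is a homotopy between multiplication by \<open>x\<^sub>j\<close> and zero. It follows that every element
  of the ideal generated by the \<open>x\<^sub>j\<close> acts as zero on Koszul cohomology, which is why regular
  sequences in that ideal are visible there.\<close>

lemma koszul_homotopy:
  assumes "finite T"
  shows "koszul_d x (koszul_contraction j c) T + koszul_contraction j (koszul_d x c) T = x j * c T"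
proof (cases "j \<in> T")
  case True
  have "koszul_d x (koszul_contraction j c) T
      = (\<Sum>i\<in>T. if i = j then koszul_sign i T * koszul_sign i T * x i * c T else 0)"
    unfolding koszul_d_def
  proof (rule sum.cong[OF refl])
    fix i assume "i \<in> T"
    show "koszul_sign i T * x i * koszul_contraction j c (T - {i})
        = (if i = j then koszul_sign i T * koszul_sign i T * x i * c T else 0)"
    proof (cases "i = j")
      case i: True
      have "insert j (T - {j}) = T" using True by auto
      then have "koszul_contraction j c (T - {j}) = koszul_sign j T * c T"
        by (simp only: koszul_contraction_def) simp
      then show ?thesis unfolding i by (simp only: mult_ac if_True refl)
    next
      case False
      then have "j \<in> T - {i}" using True by auto
      then have "koszul_contraction j c (T - {i}) = 0" by (simp only: koszul_contraction_def if_True)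
      then show ?thesis using False by simp
    qed
  qed
  also have "\<dots> = koszul_sign j T * koszul_sign j T * x j * c T"
    using assms True by simp
  finally show ?thesis using True by (simp add: koszul_contraction_def)
next
  case False
  let ?U = "insert j T"
  have "koszul_contraction j (koszul_d x c) T
      = koszul_sign j ?U * (koszul_sign j ?U * x j * c (?U - {j})
          + (\<Sum>i\<in>T. koszul_sign i ?U * x i * c (?U - {i})))"
    using False assms by (simp only: koszul_contraction_def koszul_d_def if_False sum.insert[OF assms False])
  also have "\<dots> = koszul_sign j ?U * koszul_sign j ?U * x j * c T
          + (\<Sum>i\<in>T. koszul_sign j ?U * koszul_sign i ?U * (x i * c (?U - {i})))"
    using False by (simp only: Diff_insert_absorb[OF False] distrib_left sum_distrib_left mult.assoc)
  also have "(\<Sum>i\<in>T. koszul_sign j ?U * koszul_sign i ?U * (x i * c (?U - {i})))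
      = (\<Sum>i\<in>T. - (koszul_sign i T * x i * koszul_contraction j c (T - {i})))"
  proof (rule sum.cong[OF refl])
    fix i assume i: "i \<in> T"
    then have ne: "i \<noteq> j" using False by auto
    have eq: "insert j (T - {i}) = ?U - {i}" "?U - {j} = T" using False ne by auto
    have "koszul_sign i T * x i * koszul_contraction j c (T - {i})
        = (koszul_sign i (?U - {j}) * koszul_sign j (?U - {i})) * (x i * c (?U - {i}))"
    proof -
      have "koszul_contraction j c (T - {i}) = koszul_sign j (?U - {i}) * c (?U - {i})"
        using False unfolding koszul_contraction_def eq(1) by simp
      then show ?thesis unfolding eq(2) by (simp only: mult_ac)
    qed
    also have "koszul_sign i (?U - {j}) * koszul_sign j (?U - {i})
        = - (koszul_sign i ?U * koszul_sign j ?U)"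
      using i ne assms by (intro koszul_sign_both) auto
    finally have "koszul_sign i T * x i * koszul_contraction j c (T - {i})
        = - (koszul_sign i ?U * koszul_sign j ?U) * (x i * c (?U - {i}))" .
    then show "koszul_sign j ?U * koszul_sign i ?U * (x i * c (?U - {i}))
        = - (koszul_sign i T * x i * koszul_contraction j c (T - {i}))"
      by (simp only: mult_minus_left minus_minus mult.commute[of "koszul_sign j ?U" "koszul_sign i ?U"])
  qed
  finally show ?thesis
    by (simp add: sum_negf koszul_d_def[of x "koszul_contraction j c"])
qed

text \<open>The polynomial ring in the variables \<open>X\<close> is a subring of a type of polynomials. The Koszul
  argument is carried out for such a subring, with the operations of the type.\<close>

locale subring_set =
  fixes A :: "'a::comm_ring_1 set"
  assumes one_closed: "1 \<in> A"
    and diff_closed: "a \<in> A \<Longrightarrow> b \<in> A \<Longrightarrow> a - b \<in> A"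
    and mult_closed: "a \<in> A \<Longrightarrow> b \<in> A \<Longrightarrow> a * b \<in> A"
begin

lemma zero_closed: "0 \<in> A"
  using diff_closed[OF one_closed one_closed] by simp

lemma uminus_closed: "a \<in> A \<Longrightarrow> - a \<in> A"
  using diff_closed[OF zero_closed] by fastforce

lemma add_closed: "a \<in> A \<Longrightarrow> b \<in> A \<Longrightarrow> a + b \<in> A"
  using diff_closed[of a "- b"] uminus_closed by simp

lemma sum_closed: "(\<And>i. i \<in> I \<Longrightarrow> f i \<in> A) \<Longrightarrow> sum f I \<in> A"
  by (induction I rule: infinite_finite_induct) (auto intro: zero_closed add_closed)

lemma koszul_sign_closed: "koszul_sign j T \<in> A"
  by (simp add: koszul_sign_def one_closed uminus_closed)

definition ideal_set :: "'a set \<Rightarrow> bool"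
  where "ideal_set J \<longleftrightarrow> J \<subseteq> A \<and> 0 \<in> J \<and> (\<forall>x\<in>J. \<forall>y\<in>J. x + y \<in> J) \<and> (\<forall>a\<in>A. \<forall>x\<in>J. a * x \<in> J)"

definition adjoin :: "'a set \<Rightarrow> 'a \<Rightarrow> 'a set"
  where "adjoin J f = {j + f * a | j a. j \<in> J \<and> a \<in> A}"

definition nonzerodivisor_mod :: "'a set \<Rightarrow> 'a \<Rightarrow> bool"
  where "nonzerodivisor_mod J f \<longleftrightarrow> (\<forall>y\<in>A. f * y \<in> J \<longrightarrow> y \<in> J)"

lemma ideal_setD:
  assumes "ideal_set J"
  shows "x \<in> J \<Longrightarrow> x \<in> A" "0 \<in> J" "x \<in> J \<Longrightarrow> y \<in> J \<Longrightarrow> x + y \<in> J"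
    "a \<in> A \<Longrightarrow> x \<in> J \<Longrightarrow> a * x \<in> J" "x \<in> J \<Longrightarrow> - x \<in> J" "x \<in> J \<Longrightarrow> y \<in> J \<Longrightarrow> x - y \<in> J"
    "(\<And>i. i \<in> I \<Longrightarrow> g i \<in> J) \<Longrightarrow> sum g I \<in> J"
proof -
  show 1: "x \<in> J \<Longrightarrow> x \<in> A" "0 \<in> J" "\<And>x y. x \<in> J \<Longrightarrow> y \<in> J \<Longrightarrow> x + y \<in> J"
    "\<And>a x. a \<in> A \<Longrightarrow> x \<in> J \<Longrightarrow> a * x \<in> J" for x
    using assms by (auto simp: ideal_set_def)
  show n: "x \<in> J \<Longrightarrow> - x \<in> J" for x
    using 1(4)[of "- 1" x] one_closed uminus_closed by simp
  show "x \<in> J \<Longrightarrow> y \<in> J \<Longrightarrow> x - y \<in> J"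
    using 1(3)[of x "- y"] n by simp
  show "(\<And>i. i \<in> I \<Longrightarrow> g i \<in> J) \<Longrightarrow> sum g I \<in> J"
    by (induction I rule: infinite_finite_induct) (auto intro: 1)
qed

lemma ideal_set_adjoin:
  assumes J: "ideal_set J" and f: "f \<in> A"
  shows "ideal_set (adjoin J f)"
proof -
  have "a * (j + f * b) \<in> adjoin J f" if "a \<in> A" "j \<in> J" "b \<in> A" for a j b
  proof -
    have "a * (j + f * b) = a * j + f * (a * b)" by (simp add: algebra_simps)
    then show ?thesis unfolding adjoin_def using that ideal_setD(4)[OF J] mult_closed by blast
  qed
  moreover have "(j + f * b) + (j' + f * b') \<in> adjoin J f"
    if "j \<in> J" "b \<in> A" "j' \<in> J" "b' \<in> A" for j b j' b'
  proof -
    have "(j + f * b) + (j' + f * b') = (j + j') + f * (b + b')" by (simp add: algebra_simps)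
    then show ?thesis unfolding adjoin_def using that ideal_setD(3)[OF J] add_closed by blast
  qed
  moreover have "0 \<in> adjoin J f"
    unfolding adjoin_def using ideal_setD(2)[OF J] zero_closed by force
  ultimately show ?thesis
    unfolding ideal_set_def using f ideal_setD(1)[OF J] add_closed mult_closed
    by (auto simp: adjoin_def)
qed

end

locale koszul = subring_set A for A :: "'a::comm_ring_1 set" +
  fixes X :: "nat set" and x :: "nat \<Rightarrow> 'a"
  assumes finite_X: "finite X" and x_closed: "v \<in> X \<Longrightarrow> x v \<in> A"
begin

text \<open>Vanishing of the Koszul cohomology of \<open>A / J\<close> in degree \<open>n\<close>. Cochains are lifted to \<open>A\<close>, and
  being a cocycle or a coboundary is read modulo \<open>J\<close>.\<close>

definition koszul_exact :: "'a set \<Rightarrow> nat \<Rightarrow> bool"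
  where "koszul_exact J n \<longleftrightarrow> (\<forall>c. range c \<subseteq> A \<longrightarrow>
    (\<forall>T\<subseteq>X. card T = Suc n \<longrightarrow> koszul_d x c T \<in> J) \<longrightarrow>
    (\<exists>b. range b \<subseteq> A \<and> (\<forall>T\<subseteq>X. card T = n \<longrightarrow> c T - koszul_d x b T \<in> J)))"

definition var_ideal :: "'a set"
  where "var_ideal = {\<Sum>v\<in>X. a v * x v | a. range a \<subseteq> A}"

lemma var_idealI: "(\<And>v. a v \<in> A) \<Longrightarrow> (\<Sum>v\<in>X. a v * x v) \<in> var_ideal"
  unfolding var_ideal_def by blast

lemma var_idealE:
  assumes "p \<in> var_ideal"
  obtains a where "p = (\<Sum>v\<in>X. a v * x v)" "\<forall>v. a v \<in> A"
  using assms unfolding var_ideal_def by blast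

lemma var_in_var_ideal:
  assumes "v \<in> X"
  shows "x v \<in> var_ideal"
proof -
  have "(\<Sum>u\<in>X. (if u = v then 1 else 0) * x u) \<in> var_ideal"
    by (rule var_idealI) (simp add: one_closed zero_closed)
  also have "(\<Sum>u\<in>X. (if u = v then 1 else 0) * x u) = (\<Sum>u\<in>X. if u = v then x u else 0)"
    by (intro sum.cong) auto
  finally show ?thesis using assms finite_X by simp
qed

lemma ideal_set_var_ideal: "ideal_set var_ideal"
  unfolding ideal_set_def
proof (intro conjI ballI subsetI)
  show "p \<in> A" if "p \<in> var_ideal" for p
    using that by (auto elim!: var_idealE intro!: sum_closed mult_closed x_closed)
  show "0 \<in> var_ideal" using var_idealI[of "\<lambda>_. 0"] zero_closed by simp
  show "p + q \<in> var_ideal" if pq: "p \<in> var_ideal" "q \<in> var_ideal" for p q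
  proof -
    obtain a where a: "p = (\<Sum>v\<in>X. a v * x v)" "\<forall>v. a v \<in> A" using pq(1) by (rule var_idealE)
    obtain b where b: "q = (\<Sum>v\<in>X. b v * x v)" "\<forall>v. b v \<in> A" using pq(2) by (rule var_idealE)
    from a b have "p + q = (\<Sum>v\<in>X. (a v + b v) * x v)" by (simp add: sum.distrib distrib_right)
    then show ?thesis using a b var_idealI[of "\<lambda>v. a v + b v"] add_closed by simp
  qed
  show "c * p \<in> var_ideal" if "c \<in> A" "p \<in> var_ideal" for c p
  proof -
    obtain a where a: "p = (\<Sum>v\<in>X. a v * x v)" "\<forall>v. a v \<in> A"
      using \<open>p \<in> var_ideal\<close> by (rule var_idealE)
    then have "c * p = (\<Sum>v\<in>X. (c * a v) * x v)" by (simp add: sum_distrib_left mult.assoc)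
    then show ?thesis using a \<open>c \<in> A\<close> var_idealI[of "\<lambda>v. c * a v"] mult_closed by simp
  qed
qed

lemma koszul_d_diff: "koszul_d x (\<lambda>T. b T - c T) T = koszul_d x b T - koszul_d x c T"
  by (simp add: koszul_d_def right_diff_distrib sum_subtractf)

lemma koszul_d_mult: "koszul_d x (\<lambda>T. f * c T) T = f * koszul_d x c T"
  by (simp add: koszul_d_def sum_distrib_left mult.left_commute[of f])

lemma koszul_d_sum: "koszul_d x (\<lambda>T. \<Sum>v\<in>X. g v T) T = (\<Sum>v\<in>X. koszul_d x (g v) T)"
  unfolding koszul_d_def sum_distrib_left by (rule sum.swap)

lemma koszul_d_closed: "T \<subseteq> X \<Longrightarrow> range c \<subseteq> A \<Longrightarrow> koszul_d x c T \<in> A"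
  unfolding koszul_d_def by (intro sum_closed mult_closed koszul_sign_closed x_closed) auto

lemma koszul_d_in_ideal:
  assumes J: "ideal_set J" and T: "T \<subseteq> X" "card T = Suc n"
    and c: "\<And>U. U \<subseteq> X \<Longrightarrow> card U = n \<Longrightarrow> c U \<in> J"
  shows "koszul_d x c T \<in> J"
  unfolding koszul_d_def
proof (rule ideal_setD(7)[OF J])
  fix j assume j: "j \<in> T"
  have "finite T" using T finite_X finite_subset by blast
  then have "card (T - {j}) = n" using T(2) j by simp
  then have "c (T - {j}) \<in> J" using c T by blast
  then show "koszul_sign j T * x j * c (T - {j}) \<in> J"
    using T j by (intro ideal_setD(4)[OF J] mult_closed koszul_sign_closed x_closed) auto
qed

text \<open>In degree 0 the cohomology of \<open>A / J\<close> is its socle. An element of the socle is killed by \<open>f\<close>,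
  since \<open>f\<close> is a combination of the \<open>x\<^sub>v\<close>, and so it is zero.\<close>

lemma koszul_exact_0:
  assumes J: "ideal_set J" and f: "f \<in> var_ideal" and nzd: "nonzerodivisor_mod J f"
  shows "koszul_exact J 0"
  unfolding koszul_exact_def
proof (intro allI impI)
  fix c :: "nat set \<Rightarrow> 'a"
  assume c: "range c \<subseteq> A" and cocycle: "\<forall>T\<subseteq>X. card T = Suc 0 \<longrightarrow> koszul_d x c T \<in> J"
  obtain a where a: "f = (\<Sum>v\<in>X. a v * x v)" "range a \<subseteq> A" using f by (auto simp: var_ideal_def)
  have "x v * c {} \<in> J" if "v \<in> X" for v
  proof -
    have "koszul_d x c {v} = x v * c {}"
      by (simp add: koszul_d_def)
    moreover have "koszul_d x c {v} \<in> J" using cocycle that by simp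
    ultimately show ?thesis by simp
  qed
  then have "a v * (x v * c {}) \<in> J" if "v \<in> X" for v
    using a(2) that by (intro ideal_setD(4)[OF J, of "a v"]) auto
  then have "(\<Sum>v\<in>X. a v * (x v * c {})) \<in> J"
    by (rule ideal_setD(7)[OF J])
  then have "f * c {} \<in> J" by (simp add: a sum_distrib_right mult.assoc)
  then have "c {} \<in> J" using nzd c by (auto simp: nonzerodivisor_mod_def)
  then show "\<exists>b. range b \<subseteq> A \<and> (\<forall>T\<subseteq>X. card T = 0 \<longrightarrow> c T - koszul_d x b T \<in> J)"
    using finite_X zero_closed
    by (intro exI[of _ "\<lambda>_. 0"]) (auto simp: koszul_d_def dest: finite_subset)
qed

text \<open>The exact sequence \<open>0 \<rightarrow> A/J \<rightarrow> A/J \<rightarrow> A/(J, f) \<rightarrow> 0\<close>, with multiplication by \<open>f\<close> as its first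
  map, induces a long exact sequence in which \<open>f\<close> acts as zero. So \<open>H\<^sup>n\<^sup>+\<^sup>1(A/J)\<close> is a quotient of
  \<open>H\<^sup>n(A/(J, f))\<close>. The proof is the diagram chase: if \<open>c\<close> is a cocycle, then \<open>f c\<close> is the
  coboundary of the contraction of \<open>c\<close>, which is a cocycle modulo \<open>f\<close>.\<close>

lemma koszul_exact_Suc:
  assumes J: "ideal_set J" and f: "f \<in> var_ideal" and fA: "f \<in> A" and nzd: "nonzerodivisor_mod J f"
    and exact: "koszul_exact (adjoin J f) n"
  shows "koszul_exact J (Suc n)"
  unfolding koszul_exact_def
proof (intro allI impI)
  fix c :: "nat set \<Rightarrow> 'a"
  assume c: "range c \<subseteq> A" and cocycle: "\<forall>T\<subseteq>X. card T = Suc (Suc n) \<longrightarrow> koszul_d x c T \<in> J"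
  note J' = ideal_set_adjoin[OF J fA]
  obtain a where a: "f = (\<Sum>v\<in>X. a v * x v)" "range a \<subseteq> A" using f by (auto simp: var_ideal_def)
  \<comment> \<open>The contraction of \<open>c\<close> by \<open>f\<close>.\<close>
  define b where "b T = (\<Sum>v\<in>X. a v * koszul_contraction v c T)" for T
  have bA: "range b \<subseteq> A"
  proof (rule image_subsetI)
    fix T
    have "a v \<in> A" "c (insert v T) \<in> A" for v using c a(2) by auto
    then show "b T \<in> A"
      unfolding b_def koszul_contraction_def
      by (auto intro!: sum_closed mult_closed zero_closed koszul_sign_closed)
  qed
  have fc: "f * c T - koszul_d x b T \<in> J" if T: "T \<subseteq> X" "card T = Suc n" for T
  proof -
    have fin: "finite T" using T finite_X finite_subset by blast
    have "f * c T = (\<Sum>v\<in>X. a v * (x v * c T))" by (simp add: a sum_distrib_right mult.assoc)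
    also have "\<dots> = (\<Sum>v\<in>X. a v * (koszul_d x (koszul_contraction v c) T
          + koszul_contraction v (koszul_d x c) T))"
      by (simp add: koszul_homotopy[OF fin])
    also have "\<dots> = koszul_d x b T + (\<Sum>v\<in>X. a v * koszul_contraction v (koszul_d x c) T)"
      unfolding b_def by (simp add: koszul_d_sum koszul_d_mult distrib_left sum.distrib)
    finally have "f * c T - koszul_d x b T = (\<Sum>v\<in>X. a v * koszul_contraction v (koszul_d x c) T)"
      by simp
    also have "\<dots> \<in> J"
    proof (intro ideal_setD(7)[OF J] ideal_setD(4)[OF J])
      fix v assume v: "v \<in> X"
      show "a v \<in> A" using a by auto
      show "koszul_contraction v (koszul_d x c) T \<in> J"
        using v T fin cocycle ideal_setD(2)[OF J]
        by (auto simp: koszul_contraction_def intro!: ideal_setD(4)[OF J] koszul_sign_closed)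
    qed
    finally show ?thesis .
  qed
  have "koszul_d x b T \<in> adjoin J f" if T: "T \<subseteq> X" "card T = Suc n" for T
  proof -
    have "koszul_d x b T = - (f * c T - koszul_d x b T) + f * c T" by simp
    moreover have "c T \<in> A" using c by auto
    ultimately show ?thesis
      unfolding adjoin_def using ideal_setD(5)[OF J fc[OF T]] by blast
  qed
  then obtain e where e: "range e \<subseteq> A"
    "\<forall>T\<subseteq>X. card T = n \<longrightarrow> b T - koszul_d x e T \<in> adjoin J f"
    using exact[unfolded koszul_exact_def, rule_format, of b] bA by blast
  have "\<exists>g\<in>A. T \<subseteq> X \<longrightarrow> card T = n \<longrightarrow> b T - koszul_d x e T - f * g \<in> J" for T
  proof (cases "T \<subseteq> X \<and> card T = n")
    case True
    then obtain j g where "b T - koszul_d x e T = j + f * g" "j \<in> J" "g \<in> A"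
      using e unfolding adjoin_def by blast
    then show ?thesis by (intro bexI[of _ g]) auto
  qed (use zero_closed in auto)
  then obtain g where g: "\<And>T. g T \<in> A"
    "\<And>T. T \<subseteq> X \<Longrightarrow> card T = n \<Longrightarrow> b T - koszul_d x e T - f * g T \<in> J"
    by metis
  have "c T - koszul_d x g T \<in> J" if T: "T \<subseteq> X" "card T = Suc n" for T
  proof -
    have fin: "finite T" using T finite_X finite_subset by blast
    have "koszul_d x (\<lambda>T. b T - koszul_d x e T - f * g T) T \<in> J"
      using koszul_d_in_ideal[OF J T g(2)] .
    then have "koszul_d x b T - f * koszul_d x g T \<in> J"
      by (simp only: koszul_d_diff koszul_d_mult koszul_d_d[OF fin] diff_zero)
    then have "(f * c T - koszul_d x b T) + (koszul_d x b T - f * koszul_d x g T) \<in> J"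
      using ideal_setD(3)[OF J fc[OF T]] by blast
    then have "f * (c T - koszul_d x g T) \<in> J" by (simp add: algebra_simps)
    moreover have "c T - koszul_d x g T \<in> A"
      using c g(1) koszul_d_closed[OF T(1), of g] by (intro diff_closed) auto
    ultimately show ?thesis using nzd by (auto simp: nonzerodivisor_mod_def)
  qed
  then show "\<exists>b. range b \<subseteq> A \<and> (\<forall>T\<subseteq>X. card T = Suc n \<longrightarrow> c T - koszul_d x b T \<in> J)"
    using g(1) by (intro exI[of _ g]) auto
qed

text \<open>The other part of the same long exact sequence: \<open>H\<^sup>n(A/(J, f))\<close> lies between \<open>H\<^sup>n(A/J)\<close> and
  \<open>H\<^sup>n\<^sup>+\<^sup>1(A/J)\<close>.\<close>

lemma koszul_exact_adjoin:
  assumes J: "ideal_set J" and fA: "f \<in> A" and nzd: "nonzerodivisor_mod J f"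
    and exact: "koszul_exact J n" "koszul_exact J (Suc n)"
  shows "koszul_exact (adjoin J f) n"
  unfolding koszul_exact_def
proof (intro allI impI)
  fix b :: "nat set \<Rightarrow> 'a"
  assume b: "range b \<subseteq> A"
    and cocycle: "\<forall>T\<subseteq>X. card T = Suc n \<longrightarrow> koszul_d x b T \<in> adjoin J f"
  have "\<exists>c\<in>A. T \<subseteq> X \<longrightarrow> card T = Suc n \<longrightarrow> koszul_d x b T - f * c \<in> J" for T
  proof (cases "T \<subseteq> X \<and> card T = Suc n")
    case True
    then obtain j c where "koszul_d x b T = j + f * c" "j \<in> J" "c \<in> A"
      using cocycle unfolding adjoin_def by blast
    then show ?thesis by (intro bexI[of _ c]) auto
  qed (use zero_closed in auto)
  then obtain c where c: "\<And>T. c T \<in> A"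
    "\<And>T. T \<subseteq> X \<Longrightarrow> card T = Suc n \<Longrightarrow> koszul_d x b T - f * c T \<in> J"
    by metis
  have "koszul_d x c T \<in> J" if T: "T \<subseteq> X" "card T = Suc (Suc n)" for T
  proof -
    have fin: "finite T" using T finite_X finite_subset by blast
    have "koszul_d x (\<lambda>T. koszul_d x b T - f * c T) T \<in> J"
      using koszul_d_in_ideal[OF J T c(2)] .
    then have "f * koszul_d x c T \<in> J"
      using ideal_setD(5)[OF J] by (fastforce simp: koszul_d_diff koszul_d_mult koszul_d_d[OF fin])
    then show ?thesis
      using nzd koszul_d_closed[OF T(1)] c(1) by (auto simp: nonzerodivisor_mod_def)
  qed
  then obtain g where g: "range g \<subseteq> A"
    "\<forall>T\<subseteq>X. card T = Suc n \<longrightarrow> c T - koszul_d x g T \<in> J"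
    using exact(2)[unfolded koszul_exact_def, rule_format, of c] c(1) by blast
  have "koszul_d x (\<lambda>T. b T - f * g T) T \<in> J" if T: "T \<subseteq> X" "card T = Suc n" for T
  proof -
    have "(koszul_d x b T - f * c T) + f * (c T - koszul_d x g T) \<in> J"
      using g(2) T by (intro ideal_setD(3)[OF J] ideal_setD(4)[OF J] c(2) fA) auto
    then show ?thesis by (simp add: koszul_d_diff koszul_d_mult algebra_simps)
  qed
  moreover have "range (\<lambda>T. b T - f * g T) \<subseteq> A"
    using b g(1) fA by (auto intro!: diff_closed mult_closed)
  ultimately obtain e where e: "range e \<subseteq> A"
    "\<forall>T\<subseteq>X. card T = n \<longrightarrow> b T - f * g T - koszul_d x e T \<in> J"
    using exact(1)[unfolded koszul_exact_def, rule_format, of "\<lambda>T. b T - f * g T"] by blast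
  have "b T - koszul_d x e T \<in> adjoin J f" if T: "T \<subseteq> X" "card T = n" for T
  proof -
    have "b T - koszul_d x e T = (b T - f * g T - koszul_d x e T) + f * g T" by simp
    then show ?thesis unfolding adjoin_def using e(2) T g(1) by blast
  qed
  then show "\<exists>e. range e \<subseteq> A \<and> (\<forall>T\<subseteq>X. card T = n \<longrightarrow> b T - koszul_d x e T \<in> adjoin J f)"
    using e(1) by blast
qed

text \<open>A regular sequence with a socle element in its quotient is of maximal length. If \<open>g\<close> had more than
  \<open>s\<close> elements, then the cohomology of \<open>A / G 0\<close> would vanish in the degrees \<open>0, \<dots>, s\<close>. Each step
  along \<open>F\<close> costs one degree, so degree 0 would still vanish for \<open>A / F s\<close>; but \<open>w\<close> represents a
  nonzero class there.\<close>

lemma regular_chain_length_le: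
  assumes F: "\<And>i. i \<le> s \<Longrightarrow> ideal_set (F i)"
    "\<And>i. i < s \<Longrightarrow> f i \<in> var_ideal \<inter> A \<and> nonzerodivisor_mod (F i) (f i) \<and> F (Suc i) = adjoin (F i) (f i)"
    and G: "\<And>i. i \<le> l \<Longrightarrow> ideal_set (G i)"
    "\<And>i. i < l \<Longrightarrow> g i \<in> var_ideal \<inter> A \<and> nonzerodivisor_mod (G i) (g i) \<and> G (Suc i) = adjoin (G i) (g i)"
    and FG: "F 0 = G 0"
    and w: "w \<in> A" "w \<notin> F s" "\<And>v. v \<in> X \<Longrightarrow> x v * w \<in> F s"
  shows "l \<le> s"
proof (rule ccontr)
  assume "\<not> l \<le> s"
  have "koszul_exact (G i) n" if "i + n < l" for i n
    using that
  proof (induction n arbitrary: i)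
    case 0
    then show ?case using G by (intro koszul_exact_0[of _ "g i"]) auto
  next
    case (Suc n)
    then have "koszul_exact (adjoin (G i) (g i)) n"
      using Suc.IH[of "Suc i"] G(2)[of i] by simp
    then show ?case using Suc.prems G by (intro koszul_exact_Suc[of _ "g i"]) auto
  qed
  then have base: "koszul_exact (F 0) n" if "n \<le> s" for n
    using that \<open>\<not> l \<le> s\<close> FG by simp
  have "koszul_exact (F i) n" if "i + n \<le> s" for i n
    using that
  proof (induction i arbitrary: n)
    case 0
    then show ?case using base by simp
  next
    case (Suc i)
    then have "koszul_exact (adjoin (F i) (f i)) n"
      using F by (intro koszul_exact_adjoin) auto
    then show ?case using F(2)[of i] Suc.prems by simp
  qed
  then have "koszul_exact (F s) 0" by simp
  moreover have "\<forall>T\<subseteq>X. card T = Suc 0 \<longrightarrow> koszul_d x (\<lambda>_. w) T \<in> F s"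
  proof (intro allI impI)
    fix T assume "T \<subseteq> X" "card T = Suc 0"
    then obtain v where "T = {v}" "v \<in> X" by (auto simp: card_Suc_eq)
    then show "koszul_d x (\<lambda>_. w) T \<in> F s"
      using w(3) by (simp add: koszul_d_def)
  qed
  ultimately obtain b where "\<forall>T\<subseteq>X. card T = 0 \<longrightarrow> w - koszul_d x b T \<in> F s"
    unfolding koszul_exact_def using w(1) by (metis (no_types, lifting) image_subsetI)
  then have "w - koszul_d x b {} \<in> F s" by simp
  then show False using w(2) by (simp add: koszul_d_def)
qed

end

section \<open>Regular sequences on quotients of a ring\<close>

lemma (in cring) genideal_Un_insert:
  assumes J: "J \<subseteq> carrier R" and f: "f \<in> carrier R"
  shows "Idl (insert f J) = {j \<oplus> f \<otimes> a | j a. j \<in> Idl J \<and> a \<in> carrier R}" (is "_ = ?B")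
proof
  interpret I: ideal "Idl J" R by (rule genideal_ideal[OF J])
  interpret K: ideal "Idl (insert f J)" R using J f by (intro genideal_ideal) auto
  have "Idl J \<subseteq> Idl (insert f J)"
    using J f by (intro subset_Idl_subset) auto
  moreover have "f \<in> Idl (insert f J)" using genideal_self[of "insert f J"] J f by auto
  ultimately show "?B \<subseteq> Idl (insert f J)"
    by (auto intro!: K.a_closed K.I_r_closed)
  have "PIdl f = {f \<otimes> a | a. a \<in> carrier R}"
    unfolding cgenideal_def using m_comm[OF f] by (metis (no_types, lifting) m_comm[OF f])
  then have "?B = Idl J <+> PIdl f"
    unfolding set_add_def' by auto
  then have "ideal ?B R" using add_ideals[OF I.ideal_axioms cgenideal_ideal[OF f]] by simp
  moreover have "insert f J \<subseteq> ?B"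
  proof -
    have "f = \<zero> \<oplus> f \<otimes> \<one>" using f by simp
    moreover have "j = j \<oplus> f \<otimes> \<zero>" if "j \<in> J" for j using f J that by auto
    ultimately show ?thesis using genideal_self[OF J] I.zero_closed by blast
  qed
  ultimately show "Idl (insert f J) \<subseteq> ?B" by (rule genideal_minimal)
qed

lemma carrier_FactRing: "carrier (R Quot J) = (\<lambda>y. J +>\<^bsub>R\<^esub> y) ` carrier R"
  unfolding FactRing_def A_RCOSETS_def' by auto

lemma zero_FactRing: "\<zero>\<^bsub>R Quot J\<^esub> = J"
  by (simp add: FactRing_def)

text \<open>Submodules of \<open>R / J\<close> correspond to ideals of \<open>R\<close> containing \<open>J\<close>.\<close>

lemma mult_submodule_quot_module:
  assumes R: "cring R" and J: "ideal J R" and A: "A \<subseteq> carrier R"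
  shows "mult_submodule R (quot_module R J) A = (\<lambda>y. J +>\<^bsub>R\<^esub> y) ` genideal R (J \<union> A)"
proof -
  interpret R: cring R by fact
  interpret J: ideal J R by fact
  interpret Q: cring "R Quot J" by (rule J.quotient_is_cring) (rule assms(1))
  interpret h: ring_hom_ring R "R Quot J" "(+>\<^bsub>R\<^esub>) J" by (rule J.rcos_ring_hom_ring)
  interpret M: Module.module R "quot_module R J" by (rule module_quot_module[OF R J])
  have JA: "J \<union> A \<subseteq> carrier R" using A J.a_subset by auto
  interpret K: ideal "genideal R (J \<union> A)" R by (rule R.genideal_ideal[OF JA])
  have self: "J \<union> A \<subseteq> genideal R (J \<union> A)" by (rule R.genideal_self[OF JA])
  have car: "carrier (quot_module R J) = carrier (R Quot J)"
    and ad: "add (quot_module R J) = add (R Quot J)"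
    and ze: "zero (quot_module R J) = zero (R Quot J)"
    and sm: "smult (quot_module R J) = (\<lambda>a x. (J +>\<^bsub>R\<^esub> a) \<otimes>\<^bsub>R Quot J\<^esub> x)"
    by (simp_all add: quot_module_def)
  note carQ = carrier_FactRing[of R J]
  have inv: "\<ominus>\<^bsub>quot_module R J\<^esub> (J +>\<^bsub>R\<^esub> y) = J +>\<^bsub>R\<^esub> (\<ominus>\<^bsub>R\<^esub> y)" if "y \<in> carrier R" for y
  proof (rule M.minus_equality)
    have "(J +>\<^bsub>R\<^esub> (\<ominus>\<^bsub>R\<^esub> y)) \<oplus>\<^bsub>R Quot J\<^esub> (J +>\<^bsub>R\<^esub> y) = J +>\<^bsub>R\<^esub> (\<ominus>\<^bsub>R\<^esub> y \<oplus>\<^bsub>R\<^esub> y)"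
      using that by (intro h.hom_add[symmetric]) auto
    also have "\<dots> = \<zero>\<^bsub>R Quot J\<^esub>"
      unfolding R.l_neg[OF that] by (rule h.hom_zero)
    finally show "(J +>\<^bsub>R\<^esub> (\<ominus>\<^bsub>R\<^esub> y)) \<oplus>\<^bsub>quot_module R J\<^esub> (J +>\<^bsub>R\<^esub> y) = \<zero>\<^bsub>quot_module R J\<^esub>"
      by (simp only: ad ze)
    show "J +>\<^bsub>R\<^esub> y \<in> carrier (quot_module R J)"
      "J +>\<^bsub>R\<^esub> (\<ominus>\<^bsub>R\<^esub> y) \<in> carrier (quot_module R J)"
      unfolding car using that by (auto intro!: h.hom_closed simp del: h.hom_a_inv)
  qed
  have sub: "submodule ((\<lambda>y. J +>\<^bsub>R\<^esub> y) ` genideal R (J \<union> A)) R (quot_module R J)"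
  proof (rule M.submoduleI)
    show "(\<lambda>y. J +>\<^bsub>R\<^esub> y) ` genideal R (J \<union> A) \<subseteq> carrier (quot_module R J)"
      unfolding car carQ using K.a_subset by auto
    show "\<zero>\<^bsub>quot_module R J\<^esub> \<in> (\<lambda>y. J +>\<^bsub>R\<^esub> y) ` genideal R (J \<union> A)"
      unfolding ze h.hom_zero[symmetric] using K.zero_closed by blast
  next
    fix a assume "a \<in> (\<lambda>y. J +>\<^bsub>R\<^esub> y) ` genideal R (J \<union> A)"
    then obtain y where y: "a = J +>\<^bsub>R\<^esub> y" "y \<in> genideal R (J \<union> A)" by blast
    then show "\<ominus>\<^bsub>quot_module R J\<^esub> a \<in> (\<lambda>y. J +>\<^bsub>R\<^esub> y) ` genideal R (J \<union> A)"
      using inv[OF K.Icarr[OF y(2)]] K.a_inv_closed[OF y(2)] by blast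
  next
    fix a b assume "a \<in> (\<lambda>y. J +>\<^bsub>R\<^esub> y) ` genideal R (J \<union> A)"
      "b \<in> (\<lambda>y. J +>\<^bsub>R\<^esub> y) ` genideal R (J \<union> A)"
    then obtain y z where yz: "a = J +>\<^bsub>R\<^esub> y" "y \<in> genideal R (J \<union> A)"
      "b = J +>\<^bsub>R\<^esub> z" "z \<in> genideal R (J \<union> A)" by blast
    then have "a \<oplus>\<^bsub>quot_module R J\<^esub> b = J +>\<^bsub>R\<^esub> (y \<oplus>\<^bsub>R\<^esub> z)"
      using h.hom_add[OF K.Icarr K.Icarr, of y z] by (simp only: ad)
    then show "a \<oplus>\<^bsub>quot_module R J\<^esub> b \<in> (\<lambda>y. J +>\<^bsub>R\<^esub> y) ` genideal R (J \<union> A)"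
      using K.a_closed[OF yz(2,4)] by blast
  next
    fix a b assume a: "a \<in> carrier R" and "b \<in> (\<lambda>y. J +>\<^bsub>R\<^esub> y) ` genideal R (J \<union> A)"
    then obtain y where y: "b = J +>\<^bsub>R\<^esub> y" "y \<in> genideal R (J \<union> A)" by blast
    then have "a \<odot>\<^bsub>quot_module R J\<^esub> b = J +>\<^bsub>R\<^esub> (a \<otimes>\<^bsub>R\<^esub> y)"
      using h.hom_mult[OF a K.Icarr, of y] by (simp only: sm)
    then show "a \<odot>\<^bsub>quot_module R J\<^esub> b \<in> (\<lambda>y. J +>\<^bsub>R\<^esub> y) ` genideal R (J \<union> A)"
      using K.I_l_closed[OF y(2) a] by blast
  qed
  show ?thesis
  proof
    show "mult_submodule R (quot_module R J) A \<subseteq> (\<lambda>y. J +>\<^bsub>R\<^esub> y) ` genideal R (J \<union> A)"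
      unfolding mult_submodule_def
    proof (rule Inter_lower, intro CollectI conjI sub ballI)
      fix a x assume a: "a \<in> A" and x: "x \<in> carrier (quot_module R J)"
      then obtain y where y: "y \<in> carrier R" "x = J +>\<^bsub>R\<^esub> y" using car carQ by auto
      have "a \<otimes>\<^bsub>R\<^esub> y \<in> genideal R (J \<union> A)" using self a y by (intro K.I_r_closed) auto
      moreover have "a \<odot>\<^bsub>quot_module R J\<^esub> x = J +>\<^bsub>R\<^esub> (a \<otimes>\<^bsub>R\<^esub> y)"
        using a A y unfolding sm by (subst h.hom_mult) auto
      ultimately show "a \<odot>\<^bsub>quot_module R J\<^esub> x \<in> (\<lambda>y. J +>\<^bsub>R\<^esub> y) ` genideal R (J \<union> A)"
        by simp
    qed
  next
    show "(\<lambda>y. J +>\<^bsub>R\<^esub> y) ` genideal R (J \<union> A) \<subseteq> mult_submodule R (quot_module R J) A"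
      unfolding mult_submodule_def
    proof (rule Inter_greatest)
      fix N assume "N \<in> {N. submodule N R (quot_module R J) \<and>
        (\<forall>a\<in>A. \<forall>x\<in>carrier (quot_module R J). a \<odot>\<^bsub>quot_module R J\<^esub> x \<in> N)}"
      then have N: "submodule N R (quot_module R J)"
        and AN: "\<And>a x. a \<in> A \<Longrightarrow> x \<in> carrier (quot_module R J) \<Longrightarrow> a \<odot>\<^bsub>quot_module R J\<^esub> x \<in> N"
        by auto
      note NE = M.submoduleE[OF N]
      have N0: "\<zero>\<^bsub>R Quot J\<^esub> \<in> N"
      proof -
        obtain a where a: "a \<in> N" using NE(2) by blast
        then have "a \<oplus>\<^bsub>quot_module R J\<^esub> \<ominus>\<^bsub>quot_module R J\<^esub> a \<in> N" using NE(3,5) by blast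
        then show ?thesis using M.r_neg[of a] NE(1) a ze by auto
      qed
      let ?P = "{y \<in> carrier R. J +>\<^bsub>R\<^esub> y \<in> N}"
      have "ideal ?P R"
      proof (rule idealI[OF R.ring_axioms])
        show "subgroup ?P (add_monoid R)"
        proof (rule subgroup.intro)
          show "?P \<subseteq> carrier (add_monoid R)" by auto
          show "x \<otimes>\<^bsub>add_monoid R\<^esub> y \<in> ?P" if "x \<in> ?P" "y \<in> ?P" for x y
            using that NE(5)[of "J +>\<^bsub>R\<^esub> x" "J +>\<^bsub>R\<^esub> y"] by (simp add: ad)
          show "\<one>\<^bsub>add_monoid R\<^esub> \<in> ?P" using N0 by simp
          show "inv\<^bsub>add_monoid R\<^esub> x \<in> ?P" if "x \<in> ?P" for x
            using that NE(3)[of "J +>\<^bsub>R\<^esub> x"] inv[of x] by (simp add: a_inv_def[symmetric])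
        qed
        fix a x assume a: "a \<in> ?P" and x: "x \<in> carrier R"
        have "x \<odot>\<^bsub>quot_module R J\<^esub> (J +>\<^bsub>R\<^esub> a) \<in> N" using a x NE(4) by simp
        moreover have "x \<odot>\<^bsub>quot_module R J\<^esub> (J +>\<^bsub>R\<^esub> a) = J +>\<^bsub>R\<^esub> (x \<otimes>\<^bsub>R\<^esub> a)"
          using a x unfolding sm by (subst h.hom_mult) auto
        ultimately show xa: "x \<otimes>\<^bsub>R\<^esub> a \<in> ?P" using a x by simp
        then show "a \<otimes>\<^bsub>R\<^esub> x \<in> ?P" using a x by (simp add: R.m_comm)
      qed
      moreover have "J \<union> A \<subseteq> ?P"
      proof -
        have "J +>\<^bsub>R\<^esub> y \<in> N" if "y \<in> J" for y
          using N0 unfolding zero_FactRing J.a_rcos_const[OF that] .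
        moreover have "J +>\<^bsub>R\<^esub> y \<in> N" if "y \<in> A" for y
        proof -
          have y: "y \<in> carrier R" using that A by auto
          have "y \<odot>\<^bsub>quot_module R J\<^esub> (J +>\<^bsub>R\<^esub> \<one>\<^bsub>R\<^esub>) \<in> N"
            by (rule AN[OF that, unfolded car, OF h.hom_closed[OF R.one_closed]])
          moreover have "y \<odot>\<^bsub>quot_module R J\<^esub> (J +>\<^bsub>R\<^esub> \<one>\<^bsub>R\<^esub>) = J +>\<^bsub>R\<^esub> y"
            unfolding sm by (simp only: h.hom_mult[OF y R.one_closed, symmetric] R.r_one[OF y])
          ultimately show ?thesis by simp
        qed
        ultimately show ?thesis using JA by auto
      qed
      ultimately have "genideal R (J \<union> A) \<subseteq> ?P" by (rule R.genideal_minimal)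
      then show "(\<lambda>y. J +>\<^bsub>R\<^esub> y) ` genideal R (J \<union> A) \<subseteq> N" by auto
    qed
  qed
qed

lemma rcoset_in_mult_submodule_iff:
  assumes R: "cring R" and J: "ideal J R" and A: "A \<subseteq> carrier R" and y: "y \<in> carrier R"
  shows "J +>\<^bsub>R\<^esub> y \<in> mult_submodule R (quot_module R J) A \<longleftrightarrow> y \<in> genideal R (J \<union> A)"
proof -
  interpret R: cring R by fact
  interpret J: ideal J R by fact
  have JA: "J \<union> A \<subseteq> carrier R" using A J.a_subset by auto
  interpret K: ideal "genideal R (J \<union> A)" R by (rule R.genideal_ideal[OF JA])
  have self: "J \<union> A \<subseteq> genideal R (J \<union> A)" by (rule R.genideal_self[OF JA])
  have "y \<in> genideal R (J \<union> A)" if "J +>\<^bsub>R\<^esub> y = J +>\<^bsub>R\<^esub> z" "z \<in> genideal R (J \<union> A)" for z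
  proof -
    have "y \<in> J +>\<^bsub>R\<^esub> z" using that(1) J.a_rcos_self[OF y] by simp
    then obtain j where "j \<in> J" "y = j \<oplus>\<^bsub>R\<^esub> z" by (auto simp: a_r_coset_def')
    then show ?thesis using that(2) self by (auto intro!: K.a_closed)
  qed
  then show ?thesis unfolding mult_submodule_quot_module[OF R J A] by auto
qed

text \<open>Lifting elements of \<open>R / J\<close> to \<open>R\<close> removes the cosets from all that follows.\<close>

lemma regular_sequence_quot_module:
  assumes R: "cring R" and J: "ideal J R"
  shows "regular_sequence R (quot_module R J) xs \<longleftrightarrow>
    set xs \<subseteq> carrier R \<and>
    (\<forall>i<length xs. \<forall>y\<in>carrier R.
       xs ! i \<otimes>\<^bsub>R\<^esub> y \<in> genideal R (J \<union> set (take i xs)) \<longrightarrow>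
       y \<in> genideal R (J \<union> set (take i xs))) \<and>
    \<one>\<^bsub>R\<^esub> \<notin> genideal R (J \<union> set xs)"
proof (cases "set xs \<subseteq> carrier R")
  case True
  interpret R: cring R by fact
  interpret J: ideal J R by fact
  interpret h: ring_hom_ring R "R Quot J" "(+>\<^bsub>R\<^esub>) J" by (rule J.rcos_ring_hom_ring)
  have car: "carrier (quot_module R J) = (\<lambda>y. J +>\<^bsub>R\<^esub> y) ` carrier R"
    unfolding carrier_FactRing[symmetric] by (simp add: quot_module_def)
  have take: "set (take i xs) \<subseteq> carrier R" for i using True set_take_subset by fast
  have sm: "x \<odot>\<^bsub>quot_module R J\<^esub> (J +>\<^bsub>R\<^esub> y) = J +>\<^bsub>R\<^esub> (x \<otimes>\<^bsub>R\<^esub> y)"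
    if "x \<in> carrier R" "y \<in> carrier R" for x y
    using that by (simp add: quot_module_def)
  have nth: "xs ! i \<in> carrier R" if "i < length xs" for i using that True by auto
  interpret K: ideal "genideal R (J \<union> set xs)" R
    using True J.a_subset by (intro R.genideal_ideal) auto
  have "mult_submodule R (quot_module R J) (set xs) \<noteq> carrier (quot_module R J)
      \<longleftrightarrow> \<one>\<^bsub>R\<^esub> \<notin> genideal R (J \<union> set xs)"
  proof -
    have "mult_submodule R (quot_module R J) (set xs) = carrier (quot_module R J)"
      if "\<one>\<^bsub>R\<^esub> \<in> genideal R (J \<union> set xs)"
      using K.one_imp_carrier[OF that] mult_submodule_quot_module[OF R J True] car by simp
    moreover have "\<one>\<^bsub>R\<^esub> \<in> genideal R (J \<union> set xs)"
      if "mult_submodule R (quot_module R J) (set xs) = carrier (quot_module R J)"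
      unfolding rcoset_in_mult_submodule_iff[OF R J True R.one_closed, symmetric] that car
      using R.one_closed by (rule imageI)
    ultimately show ?thesis by blast
  qed
  moreover have "(\<forall>y\<in>carrier (quot_module R J).
       xs ! i \<odot>\<^bsub>quot_module R J\<^esub> y \<in> mult_submodule R (quot_module R J) (set (take i xs)) \<longrightarrow>
       y \<in> mult_submodule R (quot_module R J) (set (take i xs))) \<longleftrightarrow>
     (\<forall>y\<in>carrier R. xs ! i \<otimes>\<^bsub>R\<^esub> y \<in> genideal R (J \<union> set (take i xs)) \<longrightarrow>
       y \<in> genideal R (J \<union> set (take i xs)))" if "i < length xs" for i
  proof -
    have "xs ! i \<odot>\<^bsub>quot_module R J\<^esub> (J +>\<^bsub>R\<^esub> y) \<in> mult_submodule R (quot_module R J) (set (take i xs))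
        \<longleftrightarrow> xs ! i \<otimes>\<^bsub>R\<^esub> y \<in> genideal R (J \<union> set (take i xs))" if "y \<in> carrier R" for y
      unfolding sm[OF nth[OF \<open>i < length xs\<close>] that]
      by (intro rcoset_in_mult_submodule_iff[OF R J take] R.m_closed nth that \<open>i < length xs\<close>)
    then show ?thesis
      unfolding car ball_simps using rcoset_in_mult_submodule_iff[OF R J take] by blast
  qed
  ultimately show ?thesis unfolding regular_sequence_def by auto
qed (simp add: regular_sequence_def)
section \<open>Renaming the variables of a polynomial\<close>

abbreviation "lookup \<equiv> Poly_Mapping.lookup"
abbreviation "keys \<equiv> Poly_Mapping.keys"
abbreviation "single \<equiv> Poly_Mapping.single"

text \<open>The additive extension of a map of keys. It serves at two levels: a renaming of variables acts on
  exponent vectors by \<open>pushforward\<close>, and this action extends to polynomials by \<open>pushforward\<close> again.\<close>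

definition pushforward :: "('a \<Rightarrow> 'b) \<Rightarrow> ('a \<Rightarrow>\<^sub>0 'c::comm_monoid_add) \<Rightarrow> 'b \<Rightarrow>\<^sub>0 'c"
  where "pushforward g p = (\<Sum>m\<in>keys p. single (g m) (lookup p m))"

lemma pushforward_superset:
  assumes "finite F" "keys p \<subseteq> F"
  shows "pushforward g p = (\<Sum>m\<in>F. single (g m) (lookup p m))"
  unfolding pushforward_def using assms
  by (intro sum.mono_neutral_left) (auto simp: in_keys_iff)

lemma sum_single_lookup: "(\<Sum>m\<in>keys p. single m (lookup p m)) = p"
proof (rule poly_mapping_eqI)
  fix k
  have "lookup (\<Sum>m\<in>keys p. single m (lookup p m)) k = (\<Sum>m\<in>keys p. lookup p m when m = k)"
    by (simp add: lookup_sum lookup_single)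
  also have "\<dots> = lookup p k"
    by (cases "k \<in> keys p") (auto simp: when_def in_keys_iff)
  finally show "lookup (\<Sum>m\<in>keys p. single m (lookup p m)) k = lookup p k" .
qed

lemma pushforward_single [simp]: "pushforward g (single m c) = single (g m) c"
  by (simp add: pushforward_def)

lemma pushforward_0 [simp]: "pushforward g 0 = 0"
  by (simp add: pushforward_def)

lemma pushforward_add: "pushforward g (p + q) = pushforward g p + pushforward g q"
proof -
  let ?F = "keys p \<union> keys q"
  have "keys (p + q) \<subseteq> ?F" by (rule Poly_Mapping.keys_add)
  then show ?thesis
    by (simp add: pushforward_superset[of ?F] lookup_add single_add sum.distrib)
qed

lemma pushforward_sum: "pushforward g (\<Sum>i\<in>I. f i) = (\<Sum>i\<in>I. pushforward g (f i))"
  by (induction I rule: infinite_finite_induct) (auto simp: pushforward_add)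

lemma pushforward_diff:
  fixes p q :: "'a \<Rightarrow>\<^sub>0 'c::ab_group_add"
  shows "pushforward g (p - q) = pushforward g p - pushforward g q"
  using pushforward_add[of g "p - q" q] by simp

lemma pushforward_id [simp]: "pushforward (\<lambda>m. m) = (\<lambda>p. p)"
  by (simp add: fun_eq_iff pushforward_def sum_single_lookup)

lemma pushforward_pushforward: "pushforward g (pushforward h p) = pushforward (\<lambda>m. g (h m)) p"
  unfolding pushforward_def[of h] pushforward_def[of "\<lambda>m. g (h m)"] by (simp add: pushforward_sum)

lemma keys_pushforward: "keys (pushforward g p) \<subseteq> g ` keys p"
  unfolding pushforward_def by (rule order_trans[OF Poly_Mapping.keys_sum]) auto

lemma lookup_pushforward_inj:
  assumes "inj g"
  shows "lookup (pushforward g p) (g m) = lookup p m"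
proof -
  have "lookup (pushforward g p) (g m) = (\<Sum>k\<in>keys p. lookup p k when g k = g m)"
    by (simp add: pushforward_def lookup_sum lookup_single)
  also have "\<dots> = (\<Sum>k\<in>keys p. if k = m then lookup p k else 0)"
    using assms by (intro sum.cong) (auto simp: when_def inj_def)
  also have "\<dots> = lookup p m" by (simp add: in_keys_iff)
  finally show ?thesis .
qed

lemma pushforward_mult:
  fixes p q :: "'a::monoid_add \<Rightarrow>\<^sub>0 'c::semiring_0"
  assumes "\<And>m n. g (m + n) = g m + g n"
  shows "pushforward g (p * q) = pushforward g p * pushforward g q"
proof -
  have "p * q = (\<Sum>m\<in>keys p. \<Sum>n\<in>keys q. single (m + n) (lookup p m * lookup q n))"
    by (subst (1) sum_single_lookup[of p, symmetric], subst (1) sum_single_lookup[of q, symmetric])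
      (simp add: sum_product mult_single)
  then have "pushforward g (p * q)
      = (\<Sum>m\<in>keys p. \<Sum>n\<in>keys q. single (g m + g n) (lookup p m * lookup q n))"
    by (simp add: pushforward_sum assms)
  also have "\<dots> = pushforward g p * pushforward g q"
    by (simp add: pushforward_def sum_product mult_single)
  finally show ?thesis .
qed

lemma keys_add_nat:
  fixes m n :: "'a \<Rightarrow>\<^sub>0 nat"
  shows "keys (m + n) = keys m \<union> keys n"
  by (auto simp: in_keys_iff lookup_add)

definition relabel :: "(nat \<Rightarrow> nat) \<Rightarrow> 'k::comm_ring_1 mpoly \<Rightarrow> 'k mpoly"
  where "relabel \<rho> = pushforward (pushforward \<rho>)"

lemma relabel_simps [simp]:
  "relabel \<rho> 0 = 0" "relabel \<rho> 1 = 1" "relabel \<rho> (Var v) = Var (\<rho> v)"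
  "relabel \<rho> (p + q) = relabel \<rho> p + relabel \<rho> q"
  "relabel \<rho> (p - q) = relabel \<rho> p - relabel \<rho> q"
  "relabel \<rho> (p * q) = relabel \<rho> p * relabel \<rho> q"
  "relabel \<rho> (single m c) = single (pushforward \<rho> m) c"
  by (simp_all add: relabel_def pushforward_add pushforward_diff pushforward_mult Var_def
      flip: single_one)

lemma relabel_id [simp]: "relabel (\<lambda>v. v) p = p"
  by (simp add: relabel_def)

lemma prod_Var: "(\<Prod>i\<in>S. Var i) = (single (\<Sum>i\<in>S. single i 1) 1 :: 'k::comm_ring_1 mpoly)"
  by (induction S rule: infinite_finite_induct) (auto simp: Var_def mult_single)

lemma keys_relabel: "keys (relabel \<rho> p) \<subseteq> pushforward \<rho> ` keys p"
  unfolding relabel_def by (rule keys_pushforward)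

lemma Var_mult_eq_pushforward: "Var a * p = pushforward ((+) (single a 1)) p"
proof -
  have "Var a * p = (\<Sum>m\<in>keys p. single (single a 1) 1 * single m (lookup p m))"
    by (subst (1) sum_single_lookup[of p, symmetric]) (simp add: Var_def sum_distrib_left)
  then show ?thesis by (simp add: pushforward_def mult_single)
qed

lemma lookup_Var_mult: "lookup (Var a * p) (single a 1 + m) = lookup p m"
  unfolding Var_mult_eq_pushforward by (rule lookup_pushforward_inj) simp

text \<open>Let \<open>w\<close> be a monomial of \<open>p\<close> outside \<open>M\<close> whose exponent at \<open>a\<close> is largest. Then \<open>x\<^sub>a w\<close> is outside
  \<open>M\<close>, so its coefficient in the product vanishes, and it must cancel against \<open>x\<^sub>b w'\<close> for another
  monomial \<open>w'\<close> of \<open>p\<close>. The exponent of \<open>w'\<close> at \<open>a\<close> is larger, so \<open>w'\<close> and hence \<open>x\<^sub>b w' = x\<^sub>a w\<close> lie in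
  \<open>M\<close>, a contradiction.\<close>

lemma keys_subset_if_keys_Var_diff_mult_subset:
  fixes p :: "'k::comm_ring_1 mpoly"
  assumes "a \<noteq> b"
    and up: "\<And>w. w \<in> M \<Longrightarrow> single b 1 + w \<in> M"
    and sat: "\<And>w. single a 1 + w \<in> M \<Longrightarrow> w \<in> M"
    and p: "keys ((Var a - Var b) * p) \<subseteq> M"
  shows "keys p \<subseteq> M"
proof (rule ccontr)
  assume "\<not> keys p \<subseteq> M"
  then have "finite (keys p - M)" "keys p - M \<noteq> {}" by auto
  then have "Max ((\<lambda>w. lookup w a) ` (keys p - M)) \<in> (\<lambda>w. lookup w a) ` (keys p - M)"
    by (intro Max_in) auto
  then obtain w where w: "w \<in> keys p - M" "lookup w a = Max ((\<lambda>w. lookup w a) ` (keys p - M))"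
    by auto
  then have max: "lookup w' a \<le> lookup w a" if "w' \<in> keys p - M" for w' using that by simp
  have "single a 1 + w \<notin> M" using sat[of w] w(1) by auto
  then have "lookup ((Var a - Var b) * p) (single a 1 + w) = 0"
    using p by (auto simp: in_keys_iff)
  then have "lookup (Var b * p) (single a 1 + w) = lookup p w"
    by (simp add: left_diff_distrib lookup_minus lookup_Var_mult del: One_nat_def)
  then have "single a 1 + w \<in> keys (Var b * p)" using w(1) by (simp add: in_keys_iff)
  then obtain w' where w': "w' \<in> keys p" "single a 1 + w = single b 1 + w'"
    unfolding Var_mult_eq_pushforward using keys_pushforward by fast
  have "lookup (single a 1 + w) a = lookup (single b 1 + w') a" by (simp only: w'(2))
  then have "lookup w' a = Suc (lookup w a)"
    using assms(1) by (simp add: lookup_add lookup_single)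
  then have "w' \<in> M" using max[of w'] w'(1) by auto
  then have "single b 1 + w' \<in> M" by (rule up)
  then show False using \<open>single a 1 + w \<notin> M\<close> unfolding w'(2) by contradiction
qed

text \<open>The hypothesis \<open>sep\<close> says that the monomial ideal of \<open>M\<close> is the intersection of its saturations at
  \<open>x\<^sub>a\<close> and at \<open>x\<^sub>b\<close>. Modulo each of them the difference is a nonzerodivisor, as one of its two
  variables is.\<close>

lemma Var_diff_nonzerodivisor:
  fixes p :: "'k::comm_ring_1 mpoly"
  assumes "a \<noteq> b"
    and up: "\<And>w u. w \<in> M \<Longrightarrow> u + w \<in> M"
    and sep: "\<And>u i j. single a i + u \<in> M \<Longrightarrow> single b j + u \<in> M \<Longrightarrow> u \<in> M"
    and p: "keys ((Var a - Var b) * p) \<subseteq> M"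
  shows "keys p \<subseteq> M"
proof -
  define sat where "sat v = {w. \<exists>i. single v i + w \<in> M}" for v
  have M_sat: "M \<subseteq> sat v" for v unfolding sat_def using up[of _ "single v 0"] by blast
  have sat_up: "u + w \<in> sat v" if w: "w \<in> sat v" for u v w
  proof -
    obtain i where "single v i + w \<in> M" using w unfolding sat_def by blast
    then have "u + (single v i + w) \<in> M" by (rule up)
    then have "single v i + (u + w) \<in> M" by (simp only: add.left_commute)
    then show ?thesis unfolding sat_def by blast
  qed
  have sat_sat: "w \<in> sat v" if w: "single v 1 + w \<in> sat v" for v w
  proof -
    obtain i where "single v i + (single v 1 + w) \<in> M" using w unfolding sat_def by blast
    then have "single v (i + 1) + w \<in> M" by (simp only: single_add add.assoc)
    then show ?thesis unfolding sat_def by blast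
  qed
  have "keys p \<subseteq> sat a"
    by (rule keys_subset_if_keys_Var_diff_mult_subset[OF assms(1) sat_up sat_sat])
      (use p M_sat[of a] in blast)+
  have "(Var b - Var a) * p = - ((Var a - Var b) * p)" by (simp add: algebra_simps)
  then have swap: "keys ((Var b - Var a) * p) = keys ((Var a - Var b) * p)"
    by (simp add: in_keys_iff set_eq_iff)
  have "keys p \<subseteq> sat b"
    by (rule keys_subset_if_keys_Var_diff_mult_subset[OF assms(1)[symmetric] sat_up sat_sat])
      (use p swap M_sat[of b] in blast)+
  show ?thesis
  proof (intro subsetI)
    fix w assume "w \<in> keys p"
    then have "w \<in> sat a" "w \<in> sat b" using \<open>keys p \<subseteq> sat a\<close> \<open>keys p \<subseteq> sat b\<close> by auto
    then obtain i j where "single a i + w \<in> M" "single b j + w \<in> M" unfolding sat_def by blast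
    then show "w \<in> M" by (rule sep)
  qed
qed

section \<open>Ideals of polynomial rings\<close>

lemma mpoly_ring_simps:
  "p \<in> carrier (mpoly_ring X) \<longleftrightarrow> (\<forall>m\<in>keys p. keys m \<subseteq> X)"
  "mult (mpoly_ring X) = (*)" "add (mpoly_ring X) = (+)"
  "one (mpoly_ring X) = 1" "zero (mpoly_ring X) = 0"
  by (simp_all add: mpoly_ring_def)

lemma a_inv_mpoly_ring:
  assumes "p \<in> carrier (mpoly_ring X)"
  shows "\<ominus>\<^bsub>mpoly_ring X\<^esub> p = - (p :: 'k::comm_ring_1 mpoly)"
proof -
  interpret R: cring "mpoly_ring X :: 'k mpoly ring" by (rule cring_mpoly_ring)
  show ?thesis
    using R.l_neg[OF assms] by (simp add: mpoly_ring_simps(3,5) eq_neg_iff_add_eq_0)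
qed

lemma subring_set_mpoly_ring: "subring_set (carrier (mpoly_ring X :: 'k::comm_ring_1 mpoly ring))"
proof
  interpret R: cring "mpoly_ring X :: 'k mpoly ring" by (rule cring_mpoly_ring)
  show "1 \<in> carrier (mpoly_ring X :: 'k mpoly ring)"
    using R.one_closed by (simp add: mpoly_ring_simps(4))
  fix a b :: "'k mpoly" assume ab: "a \<in> carrier (mpoly_ring X)" "b \<in> carrier (mpoly_ring X)"
  show "a * b \<in> carrier (mpoly_ring X)" using R.m_closed[OF ab] by (simp add: mpoly_ring_simps(2))
  show "a - b \<in> carrier (mpoly_ring X)"
    using R.a_closed[OF ab(1) R.a_inv_closed[OF ab(2)]]
    by (simp add: mpoly_ring_simps(3) a_inv_mpoly_ring[OF ab(2)])
qed

lemma ideal_mpoly_ring_iff: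
  "ideal J (mpoly_ring X :: 'k::comm_ring_1 mpoly ring) \<longleftrightarrow>
    subring_set.ideal_set (carrier (mpoly_ring X)) J"
proof
  interpret R: cring "mpoly_ring X :: 'k mpoly ring" by (rule cring_mpoly_ring)
  interpret A: subring_set "carrier (mpoly_ring X :: 'k mpoly ring)" by (rule subring_set_mpoly_ring)
  show "A.ideal_set J" if "ideal J (mpoly_ring X)"
  proof -
    interpret J: ideal J "mpoly_ring X" by fact
    show ?thesis
      unfolding A.ideal_set_def
      using J.a_subset J.zero_closed J.a_closed J.I_l_closed
      by (auto simp: mpoly_ring_simps(2-5))
  qed
  show "ideal J (mpoly_ring X)" if J: "A.ideal_set J"
  proof (rule idealI[OF R.ring_axioms])
    show "subgroup J (add_monoid (mpoly_ring X))"
    proof (rule subgroup.intro)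
      show "J \<subseteq> carrier (add_monoid (mpoly_ring X))" using A.ideal_setD(1)[OF J] by auto
      show "x \<otimes>\<^bsub>add_monoid (mpoly_ring X)\<^esub> y \<in> J" if "x \<in> J" "y \<in> J" for x y
        using that A.ideal_setD(3)[OF J] by (simp add: mpoly_ring_simps)
      show "\<one>\<^bsub>add_monoid (mpoly_ring X)\<^esub> \<in> J" using A.ideal_setD(2)[OF J] by (simp add: mpoly_ring_simps)
      show "inv\<^bsub>add_monoid (mpoly_ring X)\<^esub> x \<in> J" if "x \<in> J" for x
        using that A.ideal_setD(5)[OF J] a_inv_mpoly_ring[OF A.ideal_setD(1)[OF J]]
        by (simp add: a_inv_def)
    qed
    fix a x assume "a \<in> J" "x \<in> carrier (mpoly_ring X :: 'k mpoly ring)"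
    then show "x \<otimes>\<^bsub>mpoly_ring X\<^esub> a \<in> J" "a \<otimes>\<^bsub>mpoly_ring X\<^esub> x \<in> J"
      using A.ideal_setD(4)[OF J] by (simp_all add: mpoly_ring_simps(2) mult.commute[of a])
  qed
qed

lemma Var_closed: "v \<in> X \<Longrightarrow> Var v \<in> carrier (mpoly_ring X)"
  by (auto simp: mpoly_ring_simps Var_def split: if_splits)

lemma single_closed: "keys m \<subseteq> X \<Longrightarrow> single m c \<in> carrier (mpoly_ring X)"
  by (auto simp: mpoly_ring_simps)

lemma genideal_mpoly_ring_insert:
  fixes J :: "'k::comm_ring_1 mpoly set"
  assumes "J \<subseteq> carrier (mpoly_ring X)" "f \<in> carrier (mpoly_ring X)"
  shows "genideal (mpoly_ring X) (insert f J)
    = subring_set.adjoin (carrier (mpoly_ring X)) (genideal (mpoly_ring X) J) f"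
proof -
  interpret R: cring "mpoly_ring X :: 'k mpoly ring" by (rule cring_mpoly_ring)
  interpret A: subring_set "carrier (mpoly_ring X :: 'k mpoly ring)" by (rule subring_set_mpoly_ring)
  show ?thesis
    using R.genideal_Un_insert[OF assms] by (simp add: A.adjoin_def mpoly_ring_simps(2,3))
qed

text \<open>Renaming is a ring homomorphism, so congruence of each variable to its new name suffices.\<close>

lemma diff_relabel_in_ideal:
  fixes J :: "'k::comm_ring_1 mpoly set"
  assumes J: "ideal J (mpoly_ring X)"
    and \<rho>: "\<And>v. v \<in> X \<Longrightarrow> \<rho> v \<in> X" "\<And>v. v \<in> X \<Longrightarrow> Var v - Var (\<rho> v) \<in> J"
    and p: "p \<in> carrier (mpoly_ring X)"
  shows "p - relabel \<rho> p \<in> J"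
proof -
  interpret A: subring_set "carrier (mpoly_ring X :: 'k mpoly ring)" by (rule subring_set_mpoly_ring)
  note D = A.ideal_setD[OF J[unfolded ideal_mpoly_ring_iff]]
  have keys_\<rho>: "keys (pushforward \<rho> m) \<subseteq> X" if "keys m \<subseteq> X" for m :: "nat \<Rightarrow>\<^sub>0 nat"
    using keys_pushforward[of \<rho> m] that \<rho>(1) by blast
  define good where "good m \<longleftrightarrow> keys m \<subseteq> X \<and> (single m 1 - single (pushforward \<rho> m) 1 :: 'k mpoly) \<in> J"
    for m :: "nat \<Rightarrow>\<^sub>0 nat"
  have good_add: "good (m + m')" if m: "good m" "good m'" for m m'
  proof -
    have "(single (m + m') 1 - single (pushforward \<rho> (m + m')) 1 :: 'k mpoly)
        = single m 1 * (single m' 1 - single (pushforward \<rho> m') 1)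
          + single (pushforward \<rho> m') 1 * (single m 1 - single (pushforward \<rho> m) 1)"
      by (simp add: algebra_simps mult_single pushforward_add)
    also have "\<dots> \<in> J"
      using m unfolding good_def by (intro D(3) D(4) single_closed keys_\<rho>) auto
    finally show ?thesis using m by (auto simp: good_def keys_add_nat)
  qed
  have good_0: "good 0" by (simp add: good_def D(2))
  have good_single: "good (single v c)" if "v \<in> X" for v c
  proof (induction c)
    case (Suc c)
    have "good (single v 1)" using \<rho>(2)[OF that] that by (simp add: good_def Var_def)
    then have "good (single v 1 + single v c)" using Suc by (rule good_add)
    then show ?case by (simp add: single_add[symmetric])
  qed (simp add: good_0)
  have good: "good m" if "keys m \<subseteq> X" for m
  proof -
    have "good (\<Sum>v\<in>S. single v (lookup m v))" if "S \<subseteq> X" for S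
      using that by (induction S rule: infinite_finite_induct) (auto intro: good_0 good_add good_single)
    then show ?thesis using that sum_single_lookup[of m] by metis
  qed
  have "p - relabel \<rho> p = (\<Sum>m\<in>keys p. single m (lookup p m) - single (pushforward \<rho> m) (lookup p m))"
    by (simp add: relabel_def pushforward_def[of "pushforward \<rho>" p] sum_subtractf sum_single_lookup)
  also have "\<dots> \<in> J"
  proof (rule D(7))
    fix m assume "m \<in> keys p"
    then have "keys m \<subseteq> X" using p by (auto simp: mpoly_ring_simps)
    then have "single 0 (lookup p m) * (single m 1 - single (pushforward \<rho> m) 1) \<in> J"
      using good[of m] unfolding good_def by (intro D(4) single_closed) auto
    then show "single m (lookup p m) - single (pushforward \<rho> m) (lookup p m) \<in> J"
      by (simp add: right_diff_distrib mult_single)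
  qed
  finally show ?thesis .
qed

section \<open>Depth of quotients of polynomial rings\<close>

text \<open>Depth is computed by a single regular sequence as soon as a socle element bounds the length of all
  the others.\<close>

lemma depth_quot_module_eq:
  fixes J :: "'k::comm_ring_1 mpoly set"
  assumes X: "finite X" and J: "ideal J (mpoly_ring X)"
    and fs: "set fs \<subseteq> irrelevant_ideal X" "regular_sequence (mpoly_ring X) (quot_module (mpoly_ring X) J) fs"
    and w: "w \<in> carrier (mpoly_ring X)" "w \<notin> genideal (mpoly_ring X) (J \<union> set fs)"
      "\<And>v. v \<in> X \<Longrightarrow> Var v * w \<in> genideal (mpoly_ring X) (J \<union> set fs)"
  shows "depth (mpoly_ring X) (irrelevant_ideal X) (quot_module (mpoly_ring X) J) = enat (length fs)"
proof -
  let ?R = "mpoly_ring X :: 'k mpoly ring"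
  interpret R: cring ?R by (rule cring_mpoly_ring)
  interpret K: koszul "carrier ?R" X Var
    by (intro koszul.intro koszul_axioms.intro subring_set_mpoly_ring X Var_closed)
  have "Var ` X \<subseteq> K.var_ideal" using K.var_in_var_ideal by auto
  then have irr: "irrelevant_ideal X \<subseteq> K.var_ideal"
    unfolding irrelevant_ideal_def
    by (intro R.genideal_minimal) (simp_all add: ideal_mpoly_ring_iff K.ideal_set_var_ideal)
  have JA: "J \<subseteq> carrier ?R" using J by (auto simp: ideal_mpoly_ring_iff dest: K.ideal_setD)
  define chain where "chain xs i = genideal ?R (J \<union> set (take i xs))" for xs i
  have chain: "K.ideal_set (chain xs i)"
    "i < length xs \<Longrightarrow> xs ! i \<in> K.var_ideal \<inter> carrier ?R \<and> K.nonzerodivisor_mod (chain xs i) (xs ! i) \<and>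
        chain xs (Suc i) = K.adjoin (chain xs i) (xs ! i)"
    if xs: "set xs \<subseteq> irrelevant_ideal X" "regular_sequence ?R (quot_module ?R J) xs" for xs i
  proof -
    have xsR: "set xs \<subseteq> carrier ?R"
      and reg: "\<And>i y. i < length xs \<Longrightarrow> y \<in> carrier ?R \<Longrightarrow> xs ! i * y \<in> chain xs i \<Longrightarrow> y \<in> chain xs i"
      using xs(2)[unfolded regular_sequence_quot_module[OF cring_mpoly_ring J]]
      unfolding mpoly_ring_simps(2) chain_def by blast+
    have sub: "J \<union> set (take i xs) \<subseteq> carrier ?R"
      using xsR JA set_take_subset[of i xs] by (blast intro: order_trans)
    show "K.ideal_set (chain xs i)"
      unfolding chain_def using R.genideal_ideal[OF sub] by (simp add: ideal_mpoly_ring_iff)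
    assume i: "i < length xs"
    have "chain xs (Suc i) = genideal ?R (insert (xs ! i) (J \<union> set (take i xs)))"
      using i by (simp add: chain_def take_Suc_conv_app_nth)
    then have "chain xs (Suc i) = K.adjoin (chain xs i) (xs ! i)"
      using genideal_mpoly_ring_insert[OF sub] xsR nth_mem[OF i] by (simp add: chain_def subset_iff)
    then show "xs ! i \<in> K.var_ideal \<inter> carrier ?R \<and> K.nonzerodivisor_mod (chain xs i) (xs ! i) \<and>
        chain xs (Suc i) = K.adjoin (chain xs i) (xs ! i)"
      using reg[OF i] irr xs(1) xsR nth_mem[OF i] unfolding K.nonzerodivisor_mod_def by blast
  qed
  have "length xs \<le> length fs"
    if xs: "set xs \<subseteq> irrelevant_ideal X" "regular_sequence ?R (quot_module ?R J) xs" for xs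
  proof (rule K.regular_chain_length_le[where F = "chain fs" and f = "(!) fs" and
        G = "chain xs" and g = "(!) xs" and w = w])
    show "chain fs 0 = chain xs 0" by (simp add: chain_def)
    show "w \<notin> chain fs (length fs)" "\<And>v. v \<in> X \<Longrightarrow> Var v * w \<in> chain fs (length fs)"
      using w(2,3) by (simp_all add: chain_def)
  qed (intro chain fs xs w(1); assumption)+
  then show ?thesis
    unfolding depth_def using fs by (intro antisym SUP_least SUP_upper2[of fs]) auto
qed

section \<open>Powers of monomial ideals\<close>

definition monomial_ideal :: "nat set \<Rightarrow> (nat \<Rightarrow>\<^sub>0 nat) set \<Rightarrow> 'k::comm_ring_1 mpoly set"
  where "monomial_ideal X E =
    {p \<in> carrier (mpoly_ring X). \<forall>m\<in>keys p. \<exists>e\<in>E. \<exists>w. m = e + w}"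

primrec sum_power :: "(nat \<Rightarrow>\<^sub>0 nat) set \<Rightarrow> nat \<Rightarrow> (nat \<Rightarrow>\<^sub>0 nat) set"
  where "sum_power E 0 = {0}"
  | "sum_power E (Suc k) = {m + e | m e. m \<in> sum_power E k \<and> e \<in> E}"

lemma ideal_monomial_ideal: "ideal (monomial_ideal X E) (mpoly_ring X :: 'k::comm_ring_1 mpoly ring)"
proof -
  interpret A: subring_set "carrier (mpoly_ring X :: 'k mpoly ring)" by (rule subring_set_mpoly_ring)
  have "\<exists>e\<in>E. \<exists>w. m = e + w"
    if m: "m \<in> keys (a * p)" and p: "\<forall>m\<in>keys p. \<exists>e\<in>E. \<exists>w. m = e + w" for m and a p :: "'k mpoly"
  proof -
    obtain u v where "m = u + v" "v \<in> keys p" using m Poly_Mapping.keys_mult by blast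
    then show ?thesis using p by (metis add.left_commute)
  qed
  moreover have "\<exists>e\<in>E. \<exists>w. m = e + w"
    if "m \<in> keys (p + q)" "\<forall>m\<in>keys p. \<exists>e\<in>E. \<exists>w. m = e + w"
      "\<forall>m\<in>keys q. \<exists>e\<in>E. \<exists>w. m = e + w" for m and p q :: "'k mpoly"
    using that Poly_Mapping.keys_add[of p q] by blast
  ultimately show ?thesis
    unfolding ideal_mpoly_ring_iff A.ideal_set_def monomial_ideal_def
    by (auto intro: A.add_closed A.mult_closed A.zero_closed) 
qed

lemma monomial_ideal_subset:
  fixes J :: "'k::comm_ring_1 mpoly set"
  assumes J: "ideal J (mpoly_ring X)" and E: "\<And>e. e \<in> E \<Longrightarrow> single e 1 \<in> J"
  shows "monomial_ideal X E \<subseteq> J"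
proof
  interpret A: subring_set "carrier (mpoly_ring X :: 'k mpoly ring)" by (rule subring_set_mpoly_ring)
  note D = A.ideal_setD[OF J[unfolded ideal_mpoly_ring_iff]]
  fix p :: "'k mpoly" assume p: "p \<in> monomial_ideal X E"
  have "single m (lookup p m) \<in> J" if m: "m \<in> keys p" for m
  proof -
    obtain e w where e: "e \<in> E" "m = e + w" using p m unfolding monomial_ideal_def by blast
    have "keys m \<subseteq> X" using p m by (auto simp: monomial_ideal_def mpoly_ring_simps)
    then have "keys w \<subseteq> X" by (simp add: e(2) keys_add_nat)
    then have "single w (lookup p m) * single e 1 \<in> J"
      using D(4) E[OF e(1)] single_closed by blast
    then show ?thesis by (simp add: mult_single e(2) add.commute)
  qed
  then have "(\<Sum>m\<in>keys p. single m (lookup p m)) \<in> J" by (rule D(7))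
  then show "p \<in> J" by (simp add: sum_single_lookup)
qed

lemma single_in_monomial_ideal:
  assumes "keys m \<subseteq> X" "e \<in> E" "m = e + w"
  shows "single m c \<in> monomial_ideal X E"
  using assms by (auto simp: monomial_ideal_def mpoly_ring_simps)

lemma genideal_single_eq_monomial_ideal:
  assumes E: "\<And>e. e \<in> E \<Longrightarrow> keys e \<subseteq> X"
  shows "genideal (mpoly_ring X) ((\<lambda>e. single e 1) ` E) = (monomial_ideal X E :: 'k::comm_ring_1 mpoly set)"
proof
  interpret R: cring "mpoly_ring X :: 'k mpoly ring" by (rule cring_mpoly_ring)
  have sub: "(\<lambda>e. single e 1) ` E \<subseteq> carrier (mpoly_ring X :: 'k mpoly ring)"
    using E single_closed by blast
  show "genideal (mpoly_ring X) ((\<lambda>e. single e 1) ` E) \<subseteq> (monomial_ideal X E :: 'k mpoly set)"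
    using E by (intro R.genideal_minimal ideal_monomial_ideal)
      (auto intro!: single_in_monomial_ideal[where w = 0])
  show "(monomial_ideal X E :: 'k mpoly set) \<subseteq> genideal (mpoly_ring X) ((\<lambda>e. single e 1) ` E)"
    using R.genideal_self[OF sub] by (intro monomial_ideal_subset R.genideal_ideal sub) auto
qed

lemma keys_sum_power:
  assumes "\<And>e. e \<in> E \<Longrightarrow> keys e \<subseteq> X" "m \<in> sum_power E k"
  shows "keys m \<subseteq> X"
  using assms(2) proof (induction k arbitrary: m)
  case (Suc k)
  then obtain u e where "m = u + e" "u \<in> sum_power E k" "e \<in> E" by auto
  then show ?case using Suc.IH assms(1) by (simp add: keys_add_nat)
qed simp

lemma monomial_ideal_power:
  assumes E: "\<And>e. e \<in> E \<Longrightarrow> keys e \<subseteq> X"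
  shows "monomial_ideal X E [^]\<^bsub>ideals_set (mpoly_ring X)\<^esub> k
    = (monomial_ideal X (sum_power E k) :: 'k::comm_ring_1 mpoly set)"
proof (induction k)
  case 0
  then show ?case by (auto simp: monomial_ideal_def ideals_set_def)
next
  case (Suc k)
  let ?R = "mpoly_ring X :: 'k mpoly ring"
  interpret R: cring ?R by (rule cring_mpoly_ring)
  let ?I = "monomial_ideal X E :: 'k mpoly set"
  let ?J = "monomial_ideal X (sum_power E k) :: 'k mpoly set"
  let ?K = "monomial_ideal X (sum_power E (Suc k)) :: 'k mpoly set"
  interpret A: subring_set "carrier ?R" by (rule subring_set_mpoly_ring)
  note D = A.ideal_setD[OF ideal_monomial_ideal[of X "sum_power E (Suc k)",
    unfolded ideal_mpoly_ring_iff]]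
  have "ideal_prod ?R ?J ?I = ?K"
  proof
    show "ideal_prod ?R ?J ?I \<subseteq> ?K"
    proof
      fix s assume "s \<in> ideal_prod ?R ?J ?I"
      then show "s \<in> ?K"
      proof induction
        case (prod p q)
        have "\<exists>e\<in>sum_power E (Suc k). \<exists>w. m = e + w" if m: "m \<in> keys (p * q)" for m
        proof -
          obtain a b where ab: "a \<in> keys p" "b \<in> keys q" "m = a + b"
            using m Poly_Mapping.keys_mult by blast
          obtain a' u where a': "a' \<in> sum_power E k" "a = a' + u"
            using ab(1) prod(1) unfolding monomial_ideal_def by blast
          obtain b' v where b': "b' \<in> E" "b = b' + v"
            using ab(2) prod(2) unfolding monomial_ideal_def by blast
          have "m = (a' + b') + (u + v)" using ab a' b' by (simp add: ac_simps)
          then show ?thesis using a'(1) b'(1) by auto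
        qed
        moreover have "p * q \<in> carrier ?R"
          using prod A.mult_closed unfolding monomial_ideal_def by blast
        ultimately show ?case by (simp add: monomial_ideal_def mpoly_ring_simps(2))
      next
        case (sum s1 s2)
        then show ?case using D(3) by (simp add: mpoly_ring_simps(3))
      qed
    qed
    show "?K \<subseteq> ideal_prod ?R ?J ?I"
    proof (rule monomial_ideal_subset)
      show "ideal (ideal_prod ?R ?J ?I) ?R"
        by (intro R.ideal_prod_is_ideal ideal_monomial_ideal)
      fix e assume "e \<in> sum_power E (Suc k)"
      then obtain m e' where e: "e = m + e'" "m \<in> sum_power E k" "e' \<in> E" by auto
      have "(single m 1 :: 'k mpoly) \<in> ?J"
        by (rule single_in_monomial_ideal[where w = 0 and e = m]) (use e keys_sum_power[OF E e(2)] in auto)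
      moreover have "(single e' 1 :: 'k mpoly) \<in> ?I"
        by (rule single_in_monomial_ideal[where w = 0 and e = e']) (use e E in auto)
      ultimately have "single m 1 \<otimes>\<^bsub>?R\<^esub> single e' 1 \<in> ideal_prod ?R ?J ?I"
        by (rule ideal_prod.prod)
      then show "single e 1 \<in> ideal_prod ?R ?J ?I" by (simp add: e mult_single mpoly_ring_simps(2))
    qed
  qed
  then show ?case unfolding nat_pow_Suc Suc.IH by (simp add: ideals_set_def)
qed

section \<open>Sorted sequences\<close>

lemma list_all2_insort:
  fixes R :: "'a::linorder \<Rightarrow> 'b::linorder \<Rightarrow> bool"
  assumes mono: "\<And>x x' y y'. R x y \<Longrightarrow> x' \<le> x \<Longrightarrow> y \<le> y' \<Longrightarrow> R x' y'"
    and "list_all2 R xs ys" "sorted xs" "sorted ys" "R x y"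
  shows "list_all2 R (insort x xs) (insort y ys)"
  using assms(2-)
proof (induction arbitrary: x y rule: list_all2_induct)
  case Nil
  then show ?case by simp
next
  case (Cons x' xs y' ys)
  then have srt: "sorted xs" "sorted ys" by auto
  have eq: "x' # xs = insort x' xs" "y' # ys = insort y' ys"
    using Cons.prems by (simp_all add: insort_is_Cons)
  show ?case
  proof (cases "x \<le> x'"; cases "y \<le> y'")
    assume "x \<le> x'" "y \<le> y'"
    then show ?thesis using Cons by simp
  next
    assume xy: "x \<le> x'" "\<not> y \<le> y'"
    have "R x' y" using Cons.hyps(1) xy mono[of x' y' x' y] by simp
    then have "list_all2 R (insort x' xs) (insort y ys)" by (rule Cons.IH[OF srt])
    moreover have "R x y'" using Cons.hyps(1) xy mono[of x' y' x y'] by simp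
    ultimately show ?thesis using xy by (simp add: eq[symmetric])
  next
    assume xy: "\<not> x \<le> x'" "y \<le> y'"
    have "R x y'" using Cons.prems(3) xy mono[of x y x y'] by simp
    then have "list_all2 R (insort x xs) (insort y' ys)" by (rule Cons.IH[OF srt])
    moreover have "R x' y" using Cons.prems(3) xy mono[of x y x' y] by simp
    ultimately show ?thesis using xy by (simp add: eq[symmetric])
  next
    assume xy: "\<not> x \<le> x'" "\<not> y \<le> y'"
    then show ?thesis using Cons.hyps(1) Cons.IH[OF srt Cons.prems(3)] by simp
  qed
qed

text \<open>A relation such as \<open>t \<le> y - x\<close> survives a decrease of \<open>x\<close> and an increase of \<open>y\<close>. So inserting a related
  pair at its sorted positions into two sorted lists keeps them related entry by entry.\<close>

lemma list_all2_sort: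
  fixes R :: "'a::linorder \<Rightarrow> 'b::linorder \<Rightarrow> bool"
  assumes mono: "\<And>x x' y y'. R x y \<Longrightarrow> x' \<le> x \<Longrightarrow> y \<le> y' \<Longrightarrow> R x' y'"
    and "list_all2 R xs ys"
  shows "list_all2 R (sort xs) (sort ys)"
  using assms(2)
proof (induction rule: list_all2_induct)
  case (Cons x xs y ys)
  then show ?case by (auto intro!: list_all2_insort[of R] elim: mono)
qed simp

lemma sum_list_map_insort:
  fixes g :: "'a::linorder \<Rightarrow> 'b::comm_monoid_add"
  shows "sum_list (map g (insort x xs)) = g x + sum_list (map g xs)"
  by (induction xs) (auto simp: add.left_commute)

lemma sum_list_map_sort:
  fixes g :: "'a::linorder \<Rightarrow> 'b::comm_monoid_add"
  shows "sum_list (map g (sort xs)) = sum_list (map g xs)"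
  by (induction xs) (auto simp: sum_list_map_insort)

lemma sum_nth_sort:
  fixes g :: "'a::linorder \<Rightarrow> 'b::comm_monoid_add"
  shows "(\<Sum>i<k. g (sort (map f [0..<k]) ! i)) = (\<Sum>i<k. g (f i))"
proof -
  have "(\<Sum>i<k. g (sort (map f [0..<k]) ! i)) = sum_list (map g (sort (map f [0..<k])))"
    by (simp add: sum_list_sum_nth atLeast0LessThan)
  also have "\<dots> = sum_list (map g (map f [0..<k]))"
    by (rule sum_list_map_sort)
  also have "\<dots> = (\<Sum>i<k. g (f i))"
    by (simp add: sum_list_sum_nth atLeast0LessThan)
  finally show ?thesis .
qed

text \<open>The set \<open>{min f g \<le> w}\<close> is the union of the initial segments \<open>{f \<le> w}\<close> and \<open>{g \<le> w}\<close> of \<open>P\<close>, hence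
  equal to one of them, say to \<open>{f \<le> w}\<close>. Removing all points where the minimum is below \<open>w\<close> removes
  \<open>{f < w}\<close> at least, so \<open>{min f g = w}\<close> is contained in \<open>{f = w}\<close>. As a consequence, the minimum of two
  sorted sequences uses each value at most as often as one of them does.\<close>

lemma min_level_set:
  fixes f g :: "'p::linorder \<Rightarrow> 'b::linorder"
  assumes f: "\<And>x y. x \<in> P \<Longrightarrow> y \<in> P \<Longrightarrow> x \<le> y \<Longrightarrow> f x \<le> f y"
    and g: "\<And>x y. x \<in> P \<Longrightarrow> y \<in> P \<Longrightarrow> x \<le> y \<Longrightarrow> g x \<le> g y"
  shows "{x \<in> P. min (f x) (g x) = w} \<subseteq> {x \<in> P. f x = w} \<or>
    {x \<in> P. min (f x) (g x) = w} \<subseteq> {x \<in> P. g x = w}"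
proof (rule ccontr)
  assume "\<not> ?thesis"
  then obtain x y where "x \<in> P" "min (f x) (g x) = w" "f x \<noteq> w"
    "y \<in> P" "min (f y) (g y) = w" "g y \<noteq> w" by blast
  then have "x \<in> P" "g x = w" "w < f x" "y \<in> P" "f y = w" "w < g y"
    by (auto simp: min_def split: if_splits)
  then show False
    using f[of x y] g[of y x] linear[of x y] by auto
qed

lemma max_level_set:
  fixes f g :: "'p::linorder \<Rightarrow> 'b::linorder"
  assumes f: "\<And>x y. x \<in> P \<Longrightarrow> y \<in> P \<Longrightarrow> x \<le> y \<Longrightarrow> f x \<le> f y"
    and g: "\<And>x y. x \<in> P \<Longrightarrow> y \<in> P \<Longrightarrow> x \<le> y \<Longrightarrow> g x \<le> g y"
  shows "{x \<in> P. max (f x) (g x) = w} \<subseteq> {x \<in> P. f x = w} \<or>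
    {x \<in> P. max (f x) (g x) = w} \<subseteq> {x \<in> P. g x = w}"
proof (rule ccontr)
  assume "\<not> ?thesis"
  then obtain x y where "x \<in> P" "max (f x) (g x) = w" "f x \<noteq> w"
    "y \<in> P" "max (f y) (g y) = w" "g y \<noteq> w" by blast
  then have "x \<in> P" "g x = w" "f x < w" "y \<in> P" "f y = w" "g y < w"
    by (auto simp: max_def split: if_splits)
  then show False
    using f[of y x] g[of x y] linear[of x y] by auto
qed

text \<open>The degree, as the exponent that remains when all variables are renamed to the same one. In this
  form its additivity and its invariance under renaming are instances of facts on \<open>pushforward\<close>.\<close>

definition total_degree :: "('a \<Rightarrow>\<^sub>0 nat) \<Rightarrow> nat"
  where "total_degree m = lookup (pushforward (\<lambda>_. ()) m) ()"

lemma total_degree_simps [simp]: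
  "total_degree 0 = 0" "total_degree (m + m') = total_degree m + total_degree m'"
  "total_degree (single v c) = c" "total_degree (pushforward \<rho> m) = total_degree m"
  "total_degree (sum f I) = (\<Sum>i\<in>I. total_degree (f i))"
  by (simp_all add: total_degree_def pushforward_add lookup_add pushforward_pushforward
      pushforward_sum lookup_sum)

section \<open>Spread hypergraphs and their tableaux\<close>

locale spread_hypergraph =
  fixes n d :: nat and t :: "nat \<Rightarrow> int" and V :: "nat \<Rightarrow> nat set"
  assumes hypergraph: "complete_spread_hypergraph n d t V"
begin

abbreviation X :: "nat set"
  where "X \<equiv> spread_vertices d V"

definition spread_path :: "(nat \<Rightarrow> nat) \<Rightarrow> bool"
  where "spread_path p \<longleftrightarrow> (\<forall>l\<in>{1..d}. p l \<in> V l) \<and>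
    (\<forall>l\<in>{2..d}. t (l - 1) \<le> int (p l) - int (p (l - 1)))"

definition path_monomial :: "(nat \<Rightarrow> nat) \<Rightarrow> nat \<Rightarrow>\<^sub>0 nat"
  where "path_monomial p = (\<Sum>l\<in>{1..d}. single (p l) 1)"

definition edge_monomials :: "(nat \<Rightarrow>\<^sub>0 nat) set"
  where "edge_monomials = path_monomial ` Collect spread_path"

lemma d_pos: "1 \<le> d"
  using hypergraph by (simp add: complete_spread_hypergraph_def)

lemma V_block:
  assumes "l \<in> {1..d}"
  shows "finite (V l)" "V l \<noteq> {}" "V l \<subseteq> X"
proof -
  have "V l \<subseteq> {1..n}" using hypergraph assms by (simp add: complete_spread_hypergraph_def)
  then show "finite (V l)" by (rule finite_subset) simp
  show "V l \<noteq> {}" using hypergraph assms by (simp add: complete_spread_hypergraph_def)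
  show "V l \<subseteq> X" using assms by (auto simp: spread_vertices_def)
qed

lemma Max_V: "l \<in> {1..d} \<Longrightarrow> Max (V l) \<in> V l" "l \<in> {1..d} \<Longrightarrow> v \<in> V l \<Longrightarrow> v \<le> Max (V l)"
  using V_block by auto

lemma Min_V: "l \<in> {1..d} \<Longrightarrow> Min (V l) \<in> V l" "l \<in> {1..d} \<Longrightarrow> v \<in> V l \<Longrightarrow> Min (V l) \<le> v"
  using V_block by auto

lemma Max_V_in_X: "l \<in> {1..d} \<Longrightarrow> Max (V l) \<in> X"
  using Max_V(1) V_block(3) by (rule subsetD[rotated])

lemma Min_V_in_X: "l \<in> {1..d} \<Longrightarrow> Min (V l) \<in> X"
  using Min_V(1) V_block(3) by (rule subsetD[rotated])

lemma V_less: "i \<in> {1..d} \<Longrightarrow> j \<in> {1..d} \<Longrightarrow> i < j \<Longrightarrow> u \<in> V i \<Longrightarrow> v \<in> V j \<Longrightarrow> u < v"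
  using hypergraph unfolding complete_spread_hypergraph_def by blast

lemma V_unique: "i \<in> {1..d} \<Longrightarrow> j \<in> {1..d} \<Longrightarrow> v \<in> V i \<Longrightarrow> v \<in> V j \<Longrightarrow> i = j"
  using V_less[of i j v v] V_less[of j i v v] by (meson less_irrefl linorder_neqE_nat)

lemma X_block:
  assumes "v \<in> X"
  obtains l where "l \<in> {1..d}" "v \<in> V l"
  using assms by (auto simp: spread_vertices_def)

lemma finite_X: "finite X"
  using V_block by (auto simp: spread_vertices_def)

lemma spread_path_through:
  assumes "l \<in> {1..d}" "v \<in> V l"
  obtains p where "spread_path p" "p l = v"
proof -
  have "v \<in> X" using V_block[OF assms(1)] assms(2) by auto
  then obtain e where "e \<in> spread_edges d t V" "v \<in> e"
    using hypergraph by (auto simp: complete_spread_hypergraph_def)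
  then obtain p where p: "spread_path p" "v \<in> p ` {1..d}"
    by (auto simp: spread_edges_def spread_path_def)
  then obtain j where j: "j \<in> {1..d}" "v = p j" by auto
  then have "j = l" using p(1) assms V_unique[of j l v] by (auto simp: spread_path_def)
  then show ?thesis using that p j by auto
qed

lemma keys_path_monomial: "keys (path_monomial p) \<subseteq> p ` {1..d}"
  unfolding path_monomial_def by (rule order_trans[OF Poly_Mapping.keys_sum]) auto

lemma keys_edge_monomial:
  assumes "e \<in> edge_monomials"
  shows "keys e \<subseteq> X"
proof -
  obtain p where p: "e = path_monomial p" "spread_path p"
    using assms by (auto simp: edge_monomials_def)
  have "p ` {1..d} \<subseteq> X" using p(2) V_block(3) unfolding spread_path_def by blast
  then show ?thesis using keys_path_monomial[of p] unfolding p(1) by (rule order_trans[rotated])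
qed

lemma total_degree_edge_monomial: "e \<in> edge_monomials \<Longrightarrow> total_degree e = d"
  by (auto simp: edge_monomials_def path_monomial_def)

lemma total_degree_sum_power: "m \<in> sum_power edge_monomials k \<Longrightarrow> total_degree m = d * k"
  by (induction k arbitrary: m) (auto simp: total_degree_edge_monomial)

lemma edge_ideal_eq:
  "edge_ideal X (spread_edges d t V) = (monomial_ideal X edge_monomials :: 'k::comm_ring_1 mpoly set)"
proof -
  have inj: "inj_on p {1..d}" if "spread_path p" for p
  proof (rule inj_onI)
    fix i j assume "i \<in> {1..d}" "j \<in> {1..d}" "p i = p j"
    then show "i = j"
      using that V_unique[of i j "p i"] unfolding spread_path_def by metis
  qed
  have "(\<Prod>i\<in>p ` {1..d}. Var i) = (single (path_monomial p) 1 :: 'k mpoly)" if "spread_path p" for p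
    unfolding prod_Var path_monomial_def using inj[OF that] by (simp add: sum.reindex)
  moreover have "spread_edges d t V = (\<lambda>p. p ` {1..d}) ` Collect spread_path"
    unfolding spread_edges_def spread_path_def by blast
  ultimately have "(\<lambda>e. \<Prod>i\<in>e. Var i) ` spread_edges d t V = (\<lambda>e. single e (1::'k)) ` edge_monomials"
    unfolding edge_monomials_def by (simp add: image_image)
  then show ?thesis
    using genideal_single_eq_monomial_ideal[OF keys_edge_monomial] by (simp add: edge_ideal_def)
qed

definition tableau_monomial :: "nat \<Rightarrow> (nat \<Rightarrow> nat \<Rightarrow> nat) \<Rightarrow> nat \<Rightarrow>\<^sub>0 nat"
  where "tableau_monomial k e = (\<Sum>i<k. path_monomial (\<lambda>l. e l i))"

lemma tableau_monomial_in_sum_power: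
  assumes "\<And>i. i < k \<Longrightarrow> spread_path (\<lambda>l. e l i)"
  shows "tableau_monomial k e \<in> sum_power edge_monomials k"
  using assms by (induction k) (force simp: tableau_monomial_def edge_monomials_def)+

lemma sum_power_tableau:
  assumes "m \<in> sum_power edge_monomials k"
  obtains e where "\<And>i. i < k \<Longrightarrow> spread_path (\<lambda>l. e l i)" "m = tableau_monomial k e"
proof -
  have "\<exists>e. (\<forall>i<k. spread_path (\<lambda>l. e l i)) \<and> m = tableau_monomial k e"
    using assms
  proof (induction k arbitrary: m)
    case 0
    then show ?case by (simp add: tableau_monomial_def)
  next
    case (Suc k)
    then obtain u p where u: "m = u + path_monomial p" "u \<in> sum_power edge_monomials k" "spread_path p"
      by (auto simp: edge_monomials_def)
    obtain e where e: "\<forall>i<k. spread_path (\<lambda>l. e l i)" "u = tableau_monomial k e"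
      using Suc.IH[OF u(2)] by blast
    let ?e = "\<lambda>l i. if i < k then e l i else p l"
    have "m = tableau_monomial (Suc k) ?e" using u(1) e(2) by (simp add: tableau_monomial_def)
    moreover have "\<forall>i<Suc k. spread_path (\<lambda>l. ?e l i)" using e(1) u(3) by (simp add: less_Suc_eq)
    ultimately show ?case by (intro exI[of _ ?e] conjI)
  qed
  then show ?thesis using that by blast
qed

text \<open>A product of \<open>k\<close> edges is a tableau whose rows are the edges and whose columns are indexed by the
  blocks. Sorting every column keeps the monomial and, by monotonicity of the spread conditions,
  turns rows into edges again. Read block by block, a sorted tableau is one increasing sequence.\<close>

lemma sum_power_sorted_tableau:
  assumes "m \<in> sum_power edge_monomials k"
  obtains e where "\<And>i. i < k \<Longrightarrow> spread_path (\<lambda>l. e l i)" "m = tableau_monomial k e"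
    "\<And>l i j. i \<le> j \<Longrightarrow> j < k \<Longrightarrow> e l i \<le> e l j"
proof -
  obtain e where e: "\<And>i. i < k \<Longrightarrow> spread_path (\<lambda>l. e l i)" "m = tableau_monomial k e"
    using sum_power_tableau[OF assms] by blast
  define s where "s l i = sort (map (e l) [0..<k]) ! i" for l i
  have "s l i \<in> V l" if "i < k" "l \<in> {1..d}" for l i
  proof -
    have "s l i \<in> set (sort (map (e l) [0..<k]))"
      unfolding s_def by (rule nth_mem) (simp add: that)
    then show ?thesis using e(1) that by (auto simp: spread_path_def)
  qed
  moreover have "t (l - 1) \<le> int (s l i) - int (s (l - 1) i)" if "i < k" "l \<in> {2..d}" for l i
  proof -
    let ?R = "\<lambda>x y. t (l - 1) \<le> int y - int x"
    have "list_all2 ?R (map (e (l - 1)) [0..<k]) (map (e l) [0..<k])"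
      using e(1) that by (auto simp: list_all2_conv_all_nth spread_path_def)
    then have "list_all2 ?R (sort (map (e (l - 1)) [0..<k])) (sort (map (e l) [0..<k]))"
      by (intro list_all2_sort) auto
    then show ?thesis unfolding s_def using that by (auto dest: list_all2_nthD)
  qed
  ultimately have "spread_path (\<lambda>l. s l i)" if "i < k" for i
    using that by (simp add: spread_path_def)
  moreover have "m = tableau_monomial k s"
    unfolding e(2) tableau_monomial_def path_monomial_def s_def
    by (subst (1 2) sum.swap) (simp only: sum_nth_sort[where g = "\<lambda>v. single v 1"])
  moreover have "s l i \<le> s l j" if "i \<le> j" "j < k" for l i j
    unfolding s_def using that by (intro sorted_nth_mono) auto
  ultimately show ?thesis using that by blast
qed

lemma lookup_tableau_monomial:
  "lookup (pushforward \<rho> (tableau_monomial k e)) w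
    = card {x \<in> {1..d} \<times> {..<k}. \<rho> (e (fst x) (snd x)) = w}"
proof -
  have "lookup (pushforward \<rho> (tableau_monomial k e)) w
      = (\<Sum>i<k. \<Sum>l\<in>{1..d}. if \<rho> (e l i) = w then 1 else 0)"
    by (simp add: tableau_monomial_def path_monomial_def pushforward_sum lookup_sum lookup_single
        when_def cong: if_cong)
  also have "\<dots> = (\<Sum>x\<in>{1..d} \<times> {..<k}. if \<rho> (e (fst x) (snd x)) = w then 1 else 0)"
    by (subst sum.swap) (simp add: sum.cartesian_product split_beta)
  finally show ?thesis by (simp add: sum.If_cases Int_def)
qed

section \<open>Identifying neighbouring vertices of different blocks\<close>

text \<open>Identification of the largest vertex of \<open>V\<^sub>l\<close> with the smallest vertex of \<open>V\<^sub>l\<^sub>+\<^sub>1\<close> for \<open>l = 1, \<dots>, j\<close>.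
  When blocks are singletons, several identifications combine to larger classes, which are intervals
  of vertices; each class is represented by its least element.\<close>

primrec merge :: "nat \<Rightarrow> nat \<Rightarrow> nat"
  where "merge 0 v = v"
  | "merge (Suc j) v = (if v = Min (V (Suc (Suc j))) then merge j (Max (V (Suc j))) else merge j v)"

lemma merge_0 [simp]: "merge 0 = (\<lambda>v. v)"
  by (simp add: fun_eq_iff)

lemma le_Max_if_less_Min:
  assumes "l \<in> {1..<d}" "u \<in> X" "u < Min (V (Suc l))"
  shows "u \<le> Max (V l)"
proof -
  obtain i where i: "i \<in> {1..d}" "u \<in> V i" using assms(2) by (rule X_block)
  have l: "l \<in> {1..d}" "Suc l \<in> {1..d}" using assms(1) by auto
  consider "i < l" | "i = l" | "i = Suc l" | "Suc l < i" by linarith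
  then show ?thesis
  proof cases
    case 1
    then show ?thesis using V_less[OF i(1) l(1) _ i(2) Max_V(1)[OF l(1)]] by simp
  next
    case 2
    then show ?thesis using Max_V(2) i by simp
  next
    case 3
    then show ?thesis using Min_V(2)[OF l(2)] i(2) assms(3) by fastforce
  next
    case 4
    then show ?thesis using V_less[OF l(2) i(1) _ Min_V(1)[OF l(2)] i(2)] assms(3) by simp
  qed
qed

lemma Max_less_Min: "l \<in> {1..<d} \<Longrightarrow> Max (V l) < Min (V (Suc l))"
  using V_less[of l "Suc l"] Max_V Min_V by simp

lemma merge_later:
  assumes "Suc j < l" "l \<in> {1..d}" "v \<in> V l"
  shows "merge j v = v"
  using assms(1)
proof (induction j)
  case (Suc j)
  have j: "Suc (Suc j) \<in> {1..d}" using assms(2) Suc.prems by simp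
  have "v \<noteq> Min (V (Suc (Suc j)))" using V_unique[OF j assms(2)] Min_V(1)[OF j] assms(3) Suc.prems by auto
  then show ?case using Suc by simp
qed simp

lemma merge_in_X_le:
  assumes "j < d" "v \<in> X"
  shows "merge j v \<in> X \<and> merge j v \<le> v"
  using assms
proof (induction j arbitrary: v)
  case (Suc j)
  have j: "Suc j \<in> {1..d}" "Suc j \<in> {1..<d}" using Suc.prems by auto
  have "Max (V (Suc j)) \<in> X" by (rule Max_V_in_X[OF j(1)])
  then show ?case
    using Suc.IH[of v] Suc.IH[of "Max (V (Suc j))"] Suc.prems Max_less_Min[OF j(2)] by auto
qed simp

lemma merge_mono:
  assumes "j < d" "u \<in> X" "v \<in> X" "u \<le> v"
  shows "merge j u \<le> merge j v"
  using assms
proof (induction j arbitrary: u v)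
  case (Suc j)
  let ?a = "Max (V (Suc j))" and ?b = "Min (V (Suc (Suc j)))"
  have j: "Suc j \<in> {1..d}" "Suc j \<in> {1..<d}" "j < d" using Suc.prems by auto
  have a: "?a \<in> X" by (rule Max_V_in_X[OF j(1)])
  note ab = Max_less_Min[OF j(2)]
  consider "u = ?b" "v = ?b" | "u = ?b" "v \<noteq> ?b" | "u \<noteq> ?b" "v = ?b" | "u \<noteq> ?b" "v \<noteq> ?b" by blast
  then show ?case
  proof cases
    case 2
    then show ?thesis using Suc.IH[OF j(3) a Suc.prems(3)] ab Suc.prems(4) by simp
  next
    case 3
    then have "u \<le> ?a" using le_Max_if_less_Min[OF j(2) Suc.prems(2)] Suc.prems(4) by simp
    then show ?thesis using Suc.IH[OF j(3) Suc.prems(2) a] 3 by simp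
  qed (use Suc.IH[OF j(3) Suc.prems(2,3,4)] in simp_all)
qed simp

lemma merge_Max_eq_merge_Min:
  assumes "l \<in> {1..j}" "j < d"
  shows "merge j (Max (V l)) = merge j (Min (V (Suc l)))"
  using assms
proof (induction j)
  case (Suc j)
  have ne: "Max (V i) \<noteq> Min (V (Suc (Suc j)))" "Min (V i) \<noteq> Min (V (Suc (Suc j)))"
    if "i \<in> {1..Suc j}" for i
  proof -
    have "i \<in> {1..d}" "Suc (Suc j) \<in> {1..d}" "i \<noteq> Suc (Suc j)" using that Suc.prems by auto
    then show "Max (V i) \<noteq> Min (V (Suc (Suc j)))" "Min (V i) \<noteq> Min (V (Suc (Suc j)))"
      using V_unique[of i "Suc (Suc j)"] Max_V(1)[of i] Min_V(1)[of i] Min_V(1)[of "Suc (Suc j)"]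
      by metis+
  qed
  show ?case
  proof (cases "l = Suc j")
    case True
    then show ?thesis using ne(1)[of l] Suc.prems by simp
  next
    case False
    then show ?thesis using ne(1)[of l] ne(2)[of "Suc l"] Suc by auto
  qed
qed simp

text \<open>The monomials of the ideal generated by \<open>I\<^sup>k\<close> after the first \<open>j\<close> identifications.\<close>

definition merged_multiples :: "nat \<Rightarrow> nat \<Rightarrow> (nat \<Rightarrow>\<^sub>0 nat) set"
  where "merged_multiples j k =
    {pushforward (merge j) m + w | m w. m \<in> sum_power edge_monomials k}"

lemma merged_multiples_up:
  assumes "u \<in> merged_multiples j k"
  shows "w + u \<in> merged_multiples j k"
proof -
  obtain m v where "m \<in> sum_power edge_monomials k" "u = pushforward (merge j) m + v"
    using assms unfolding merged_multiples_def by blast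
  then have "w + u = pushforward (merge j) m + (w + v)" by (simp add: add.left_commute)
  then show ?thesis
    using \<open>m \<in> _\<close> unfolding merged_multiples_def by blast
qed

lemma tableau_mono:
  assumes e: "\<And>i. i < k \<Longrightarrow> spread_path (\<lambda>l. e l i)"
    "\<And>l i j. i \<le> j \<Longrightarrow> j < k \<Longrightarrow> e l i \<le> e l j"
    and x: "x \<in> {1..d} \<times> {..<k}" "y \<in> {1..d} \<times> {..<k}" "x \<le> y"
  shows "e (fst x) (snd x) \<le> e (fst y) (snd y)"
proof -
  have "e (fst x) (snd x) \<in> V (fst x)" "e (fst y) (snd y) \<in> V (fst y)"
    using e(1)[of "snd x"] e(1)[of "snd y"] x by (auto simp: spread_path_def)
  moreover have "fst x < fst y \<or> fst x = fst y \<and> snd x \<le> snd y"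
    using x(3) by (auto simp: less_eq_prod_def)
  ultimately show ?thesis
    using V_less[of "fst x" "fst y"] x e(2)[of "snd x" "snd y" "fst x"] by (auto intro: less_imp_le)
qed

text \<open>Write \<open>a\<close> for the largest vertex of \<open>V\<^sub>j\<^sub>+\<^sub>1\<close> and \<open>b\<close> for the smallest vertex of \<open>V\<^sub>j\<^sub>+\<^sub>2\<close>. The first
  hypothesis gives a sorted tableau \<open>e\<close> that uses no class of vertices more often than \<open>u\<close> permits,
  except possibly the class of \<open>a\<close>; the second gives a tableau \<open>e'\<close> with the only possible exception
  \<open>b\<close>. Take the entrywise minimum of \<open>e\<close> and \<open>e'\<close> in the blocks up to \<open>V\<^sub>j\<^sub>+\<^sub>1\<close> and the maximum in the
  later ones. The rows are edges: minima and maxima preserve the spread conditions, and the gap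
  between the two kinds of blocks only widens. Each class is used at most as often as in one of \<open>e\<close>
  and \<open>e'\<close>. The class of \<open>a\<close> is the largest in the early blocks, so the minimum can reach it only
  where \<open>e'\<close> does; \<open>b\<close> is the smallest vertex in the late blocks, so the maximum can equal it only
  where \<open>e\<close> does.\<close>

lemma merged_multiples_separated:
  assumes j: "Suc j < d"
    and u1: "single (merge j (Max (V (Suc j)))) c1 + u \<in> merged_multiples j k"
    and u2: "single (Min (V (Suc (Suc j)))) c2 + u \<in> merged_multiples j k"
  shows "u \<in> merged_multiples j k"
proof -
  let ?a = "Max (V (Suc j))" and ?b = "Min (V (Suc (Suc j)))"
  let ?z = "merge j ?a"
  have jd: "Suc j \<in> {1..d}" "Suc (Suc j) \<in> {1..d}" "Suc j \<in> {1..<d}" "j < d" using j by auto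
  have aX: "?a \<in> X" by (rule Max_V_in_X[OF jd(1)])
  note ab = Max_less_Min[OF jd(3)]
  have za: "?z \<le> ?a" using merge_in_X_le[OF jd(4) aX] by simp
  obtain m1 v1 where m1: "m1 \<in> sum_power edge_monomials k"
    "single ?z c1 + u = pushforward (merge j) m1 + v1"
    using u1 unfolding merged_multiples_def by blast
  obtain m2 v2 where m2: "m2 \<in> sum_power edge_monomials k"
    "single ?b c2 + u = pushforward (merge j) m2 + v2"
    using u2 unfolding merged_multiples_def by blast
  obtain e where e: "\<And>i. i < k \<Longrightarrow> spread_path (\<lambda>l. e l i)" "m1 = tableau_monomial k e"
    "\<And>l i j. i \<le> j \<Longrightarrow> j < k \<Longrightarrow> e l i \<le> e l j"
    using sum_power_sorted_tableau[OF m1(1)] by blast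
  obtain e' where e': "\<And>i. i < k \<Longrightarrow> spread_path (\<lambda>l. e' l i)" "m2 = tableau_monomial k e'"
    "\<And>l i j. i \<le> j \<Longrightarrow> j < k \<Longrightarrow> e' l i \<le> e' l j"
    using sum_power_sorted_tableau[OF m2(1)] by blast
  define q where "q l i = (if l \<le> Suc j then min (e l i) (e' l i) else max (e l i) (e' l i))" for l i
  let ?P = "{1..d} \<times> {..<k}"
  let ?f = "\<lambda>x. merge j (e (fst x) (snd x))" and ?g = "\<lambda>x. merge j (e' (fst x) (snd x))"
  let ?h = "\<lambda>x. merge j (q (fst x) (snd x))"
  have eV: "e (fst x) (snd x) \<in> V (fst x)" "e' (fst x) (snd x) \<in> V (fst x)"
    "e (fst x) (snd x) \<in> X" "e' (fst x) (snd x) \<in> X" if "x \<in> ?P" for x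
  proof -
    have l: "fst x \<in> {1..d}" "snd x < k" using that by auto
    show "e (fst x) (snd x) \<in> V (fst x)" "e' (fst x) (snd x) \<in> V (fst x)"
      using e(1)[OF l(2)] e'(1)[OF l(2)] l(1) unfolding spread_path_def by blast+
    then show "e (fst x) (snd x) \<in> X" "e' (fst x) (snd x) \<in> X"
      using V_block(3)[OF l(1)] by blast+
  qed
  have f_mono: "?f x \<le> ?f y" if "x \<in> ?P" "y \<in> ?P" "x \<le> y" for x y
    using that by (intro merge_mono jd eV tableau_mono e)
  have g_mono: "?g x \<le> ?g y" if "x \<in> ?P" "y \<in> ?P" "x \<le> y" for x y
    using that by (intro merge_mono jd eV tableau_mono e')
  have merge_min: "merge j (min v w) = min (merge j v) (merge j w)" if "v \<in> X" "w \<in> X" for v w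
    using merge_mono[OF jd(4) that] merge_mono[OF jd(4) that(2,1)] by (auto simp: min_def)
  have merge_max: "merge j (max v w) = max (merge j v) (merge j w)" if "v \<in> X" "w \<in> X" for v w
    using merge_mono[OF jd(4) that] merge_mono[OF jd(4) that(2,1)] by (auto simp: max_def)
  have h: "?h x = (if fst x \<le> Suc j then min (?f x) (?g x) else max (?f x) (?g x))"
    if "x \<in> ?P" for x
    using eV[OF that] by (simp add: q_def merge_min merge_max)
  have early: "?f x \<le> ?z" "?g x \<le> ?z" if "x \<in> ?P" "fst x \<le> Suc j" for x
  proof -
    have "v \<le> ?a" if "v \<in> V (fst x)" for v
      using that V_less[of "fst x" "Suc j" v ?a] Max_V(1)[OF jd(1)] Max_V(2)[OF jd(1), of v]
        \<open>x \<in> ?P\<close> \<open>fst x \<le> Suc j\<close> jd by (cases "fst x = Suc j") (auto intro: less_imp_le)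
    then show "?f x \<le> ?z" "?g x \<le> ?z"
      using eV[OF that(1)] aX by (auto intro!: merge_mono jd)
  qed
  have late: "?b \<le> ?f x" "?b \<le> ?g x" if "x \<in> ?P" "\<not> fst x \<le> Suc j" for x
  proof -
    have "?b \<le> v" "merge j v = v" if "v \<in> V (fst x)" for v
      using that V_less[of "Suc (Suc j)" "fst x" ?b v] Min_V(1)[OF jd(2)] Min_V(2)[OF jd(2), of v]
        merge_later[of j "fst x" v] \<open>x \<in> ?P\<close> \<open>\<not> fst x \<le> Suc j\<close> jd
      by (cases "fst x = Suc (Suc j)"; auto intro: less_imp_le)+
    then show "?b \<le> ?f x" "?b \<le> ?g x" using eV[OF that(1)] by simp_all
  qed
  have card1: "card {x \<in> ?P. ?f x = w} \<le> lookup u w" if "w \<noteq> ?z" for w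
    using arg_cong[OF m1(2), of "\<lambda>m. lookup m w"] that
    unfolding lookup_add e(2) lookup_tableau_monomial by (simp add: lookup_single)
  have card2: "card {x \<in> ?P. ?g x = w} \<le> lookup u w" if "w \<noteq> ?b" for w
    using arg_cong[OF m2(2), of "\<lambda>m. lookup m w"] that
    unfolding lookup_add e'(2) lookup_tableau_monomial by (simp add: lookup_single)
  \<comment> \<open>For \<open>w\<close> equal to the class of \<open>a\<close> only \<open>e'\<close> gives a bound, for \<open>w = b\<close> only \<open>e\<close> does.\<close>
  have sub: "{x \<in> ?P. ?h x = w} \<subseteq> {x \<in> ?P. ?f x = w} \<and> w \<noteq> ?z \<or>
      {x \<in> ?P. ?h x = w} \<subseteq> {x \<in> ?P. ?g x = w} \<and> w \<noteq> ?b" for w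
  proof -
    consider "w = ?z" | "w = ?b" | "w \<noteq> ?z" "w \<noteq> ?b" by blast
    then show ?thesis
    proof cases
      case 1
      have "?g x = w" if "x \<in> ?P" "?h x = w" for x
        using that early[of x] late[of x] h[of x] za ab 1
        by (cases "fst x \<le> Suc j") (auto simp: min_def max_def split: if_splits)
      then show ?thesis using 1 za ab by auto
    next
      case 2
      have "?f x = w" if "x \<in> ?P" "?h x = w" for x
        using that early[of x] late[of x] h[of x] za ab 2
        by (cases "fst x \<le> Suc j") (auto simp: min_def max_def split: if_splits)
      then show ?thesis using 2 za ab by auto
    next
      case 3
      let ?early = "{x \<in> ?P. fst x \<le> Suc j}" and ?late = "{x \<in> ?P. \<not> fst x \<le> Suc j}"
      show ?thesis
      proof (cases "w \<le> ?z")
        case True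
        have N: "?h x \<noteq> w" if "x \<in> ?late" for x
          using that late[of x] h[of x] za ab True by (auto simp: max_def)
        have "x \<in> ?P \<and> ?h x = w \<longleftrightarrow> x \<in> ?early \<and> min (?f x) (?g x) = w" for x
          using N[of x] h[of x] by (cases "x \<in> ?P"; cases "fst x \<le> Suc j") simp_all
        then have "{x \<in> ?P. ?h x = w} = {x \<in> ?early. min (?f x) (?g x) = w}"
          by (rule Collect_cong)
        moreover have "{x \<in> ?early. min (?f x) (?g x) = w} \<subseteq> {x \<in> ?early. ?f x = w} \<or>
            {x \<in> ?early. min (?f x) (?g x) = w} \<subseteq> {x \<in> ?early. ?g x = w}"
          by (rule min_level_set) (use f_mono g_mono in blast)+
        ultimately show ?thesis using 3 by blast
      next
        case False
        have N: "?h x \<noteq> w" if "x \<in> ?early" for x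
          using that early[of x] h[of x] False by (auto simp: min_def)
        have "x \<in> ?P \<and> ?h x = w \<longleftrightarrow> x \<in> ?late \<and> max (?f x) (?g x) = w" for x
          using N[of x] h[of x] by (cases "x \<in> ?P"; cases "fst x \<le> Suc j") simp_all
        then have "{x \<in> ?P. ?h x = w} = {x \<in> ?late. max (?f x) (?g x) = w}"
          by (rule Collect_cong)
        moreover have "{x \<in> ?late. max (?f x) (?g x) = w} \<subseteq> {x \<in> ?late. ?f x = w} \<or>
            {x \<in> ?late. max (?f x) (?g x) = w} \<subseteq> {x \<in> ?late. ?g x = w}"
          by (rule max_level_set) (use f_mono g_mono in blast)+
        ultimately show ?thesis using 3 by blast
      qed
    qed
  qed
  have "card {x \<in> ?P. ?h x = w} \<le> lookup u w" for w
  proof -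
    have fin: "finite {x \<in> ?P. R x}" for R by simp
    from sub[of w] show ?thesis
    proof
      assume "{x \<in> ?P. ?h x = w} \<subseteq> {x \<in> ?P. ?f x = w} \<and> w \<noteq> ?z"
      then show ?thesis using card_mono[OF fin] card1[of w] by (meson order_trans)
    next
      assume "{x \<in> ?P. ?h x = w} \<subseteq> {x \<in> ?P. ?g x = w} \<and> w \<noteq> ?b"
      then show ?thesis using card_mono[OF fin] card2[of w] by (meson order_trans)
    qed
  qed
  then have le: "lookup (pushforward (merge j) (tableau_monomial k q)) w \<le> lookup u w" for w
    by (simp only: lookup_tableau_monomial)
  have "u = pushforward (merge j) (tableau_monomial k q)
      + (u - pushforward (merge j) (tableau_monomial k q))"
    by (rule poly_mapping_eqI) (simp add: lookup_add lookup_minus le)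
  moreover have "spread_path (\<lambda>l. q l i)" if "i < k" for i
    unfolding spread_path_def
  proof (intro conjI ballI)
    fix l assume "l \<in> {1..d}"
    then show "q l i \<in> V l"
      using e(1)[OF that] e'(1)[OF that] by (auto simp: spread_path_def q_def min_def max_def)
  next
    fix l assume "l \<in> {2..d}"
    then have "t (l - 1) \<le> int (e l i) - int (e (l - 1) i)" "t (l - 1) \<le> int (e' l i) - int (e' (l - 1) i)"
      using e(1)[OF that] e'(1)[OF that] by (auto simp: spread_path_def)
    then show "t (l - 1) \<le> int (q l i) - int (q (l - 1) i)"
      by (auto simp: q_def min_def max_def)
  qed
  then have "tableau_monomial k q \<in> sum_power edge_monomials k"
    by (rule tableau_monomial_in_sum_power)
  ultimately show ?thesis unfolding merged_multiples_def by blast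
qed

section \<open>A regular sequence\<close>

text \<open>The preimage, under the renaming of variables by \<open>merge j\<close>, of the monomial ideal that \<open>I\<^sup>k\<close> becomes.\<close>

definition merged_ideal :: "nat \<Rightarrow> nat \<Rightarrow> 'k::comm_ring_1 mpoly set"
  where "merged_ideal j k =
    {p \<in> carrier (mpoly_ring X). keys (relabel (merge j) p) \<subseteq> merged_multiples j k}"

definition connecting_differences :: "'k::comm_ring_1 mpoly list"
  where "connecting_differences = map (\<lambda>l. Var (Max (V l)) - Var (Min (V (Suc l)))) [1..<d]"

lemma ideal_merged_ideal: "ideal (merged_ideal j k) (mpoly_ring X :: 'k::comm_ring_1 mpoly ring)"
proof -
  interpret A: subring_set "carrier (mpoly_ring X :: 'k mpoly ring)" by (rule subring_set_mpoly_ring)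
  have "keys (p + q) \<subseteq> M" if "keys p \<subseteq> M" "keys q \<subseteq> M" for p q :: "'k mpoly" and M
    using that Poly_Mapping.keys_add[of p q] by blast
  moreover have "keys (a * p) \<subseteq> merged_multiples j k" if "keys p \<subseteq> merged_multiples j k" for a p :: "'k mpoly"
    using that Poly_Mapping.keys_mult[of a p] merged_multiples_up[of _ j k] by blast
  ultimately show ?thesis
    unfolding ideal_mpoly_ring_iff A.ideal_set_def merged_ideal_def
    by (auto intro: A.add_closed A.mult_closed A.zero_closed)
qed

lemma merged_ideal_0: "merged_ideal 0 k = monomial_ideal X (sum_power edge_monomials k)"
proof -
  have "m \<in> merged_multiples 0 k \<longleftrightarrow> (\<exists>e\<in>sum_power edge_monomials k. \<exists>w. m = e + w)" for m
    unfolding merged_multiples_def by auto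
  then show ?thesis by (simp add: merged_ideal_def monomial_ideal_def subset_eq)
qed

lemma length_connecting_differences [simp]: "length connecting_differences = d - 1"
  by (simp add: connecting_differences_def)

lemma nth_connecting_differences:
  "j < d - 1 \<Longrightarrow> connecting_differences ! j = Var (Max (V (Suc j))) - Var (Min (V (Suc (Suc j))))"
  by (simp add: connecting_differences_def)

lemma set_take_connecting_differences:
  assumes "j < d"
  shows "set (take j connecting_differences) = (\<lambda>l. Var (Max (V l)) - Var (Min (V (Suc l)))) ` {1..j}"
proof -
  have "set (take j [1..<d]) = {1..j}" using assms by (subst take_upt) auto
  then show ?thesis by (simp only: connecting_differences_def take_map set_map)
qed

lemma connecting_difference_closed:
  assumes "l \<in> {1..<d}"
  shows "(Var (Max (V l)) - Var (Min (V (Suc l))) :: 'k::comm_ring_1 mpoly) \<in> carrier (mpoly_ring X)"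
  using assms Max_V_in_X[of l] Min_V_in_X[of "Suc l"]
  by (intro subring_set.diff_closed[OF subring_set_mpoly_ring] Var_closed) auto

text \<open>Modulo the first \<open>j\<close> differences, every polynomial is congruent to its renaming. So membership in
  the ideal generated by \<open>I\<^sup>k\<close> and these differences can be tested after renaming, where it is a
  question about single monomials.\<close>

lemma genideal_connecting_differences:
  fixes k :: nat
  assumes j: "j < d"
  defines "I \<equiv> monomial_ideal X (sum_power edge_monomials k) :: 'k::comm_ring_1 mpoly set"
  shows "genideal (mpoly_ring X) (I \<union> set (take j connecting_differences)) = merged_ideal j k"
proof
  let ?R = "mpoly_ring X :: 'k mpoly ring"
  interpret R: cring ?R by (rule cring_mpoly_ring)
  interpret A: subring_set "carrier ?R" by (rule subring_set_mpoly_ring)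
  let ?S = "I \<union> set (take j connecting_differences)"
  let ?K = "genideal ?R ?S"
  have S: "?S \<subseteq> carrier ?R"
    unfolding set_take_connecting_differences[OF j] I_def using connecting_difference_closed[where 'k = 'k] j
    by (auto simp: monomial_ideal_def)
  have K: "ideal ?K ?R" by (rule R.genideal_ideal[OF S])
  note D = A.ideal_setD[OF K[unfolded ideal_mpoly_ring_iff]]
  have self: "?S \<subseteq> ?K" by (rule R.genideal_self[OF S])
  show "?K \<subseteq> merged_ideal j k"
  proof (rule R.genideal_minimal[OF ideal_merged_ideal], rule Un_least)
    show "I \<subseteq> merged_ideal j k"
    proof
      fix p assume p: "p \<in> I"
      have "w \<in> merged_multiples j k" if w: "w \<in> keys (relabel (merge j) p)" for w
      proof -
        obtain m where m: "m \<in> keys p" "w = pushforward (merge j) m"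
          using w keys_relabel[of "merge j" p] by blast
        then obtain e u where "e \<in> sum_power edge_monomials k" "m = e + u"
          using p unfolding I_def monomial_ideal_def by blast
        then show ?thesis unfolding merged_multiples_def m(2) by (auto simp: pushforward_add)
      qed
      then show "p \<in> merged_ideal j k" using p by (auto simp: merged_ideal_def I_def monomial_ideal_def)
    qed
    show "set (take j connecting_differences) \<subseteq> (merged_ideal j k :: 'k mpoly set)"
    proof
      fix f :: "'k mpoly" assume "f \<in> set (take j connecting_differences)"
      then obtain l where l: "l \<in> {1..j}" "f = Var (Max (V l)) - Var (Min (V (Suc l)))"
        unfolding set_take_connecting_differences[OF j] by blast
      then have "relabel (merge j) f = 0" using merge_Max_eq_merge_Min[OF l(1) j] by simp
      then show "f \<in> merged_ideal j k"
        using connecting_difference_closed[of l, where 'k = 'k] l j by (simp add: merged_ideal_def)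
    qed
  qed
  have merge_X: "merge j v \<in> X" if "v \<in> X" for v using merge_in_X_le[OF j that] by simp
  have step: "Var v - Var (merge i v) \<in> ?K" if "i \<le> j" "v \<in> X" for i v
    using that
  proof (induction i arbitrary: v)
    case 0
    then show ?case using D(2) by simp
  next
    case (Suc i)
    let ?a = "Max (V (Suc i))" and ?b = "Min (V (Suc (Suc i)))"
    show ?case
    proof (cases "v = ?b")
      case True
      have "(Var ?a - Var ?b :: 'k mpoly) \<in> set (take j connecting_differences)"
        unfolding set_take_connecting_differences[OF j] using Suc.prems(1)
        by (intro image_eqI[of _ _ "Suc i"]) auto
      then have "Var ?a - Var ?b \<in> ?K" using self by blast
      moreover have "Var ?a - Var (merge i ?a) \<in> ?K"
        using Suc.prems j Max_V_in_X[of "Suc i"] by (intro Suc.IH) auto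
      ultimately have "(Var ?a - Var (merge i ?a)) - (Var ?a - Var ?b) \<in> ?K"
        by (rule D(6)[rotated])
      then show ?thesis using True by simp
    qed (use Suc in simp)
  qed
  show "merged_ideal j k \<subseteq> ?K"
  proof
    fix p :: "'k mpoly" assume p: "p \<in> merged_ideal j k"
    then have pR: "p \<in> carrier ?R" by (simp add: merged_ideal_def)
    have diff: "q - relabel (merge j) q \<in> ?K" if "q \<in> carrier ?R" for q
      using diff_relabel_in_ideal[OF K merge_X step[OF order_refl] that] by blast
    have "single w (c :: 'k) \<in> ?K" if w: "w \<in> keys (relabel (merge j) p)" for w c
    proof -
      obtain m u where m: "m \<in> sum_power edge_monomials k" "w = pushforward (merge j) m + u"
        using p w unfolding merged_ideal_def merged_multiples_def by blast
      obtain m' where m': "m' \<in> keys p" "w = pushforward (merge j) m'"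
        using w keys_relabel[of "merge j" p] by blast
      have "keys m' \<subseteq> X" using pR m'(1) by (auto simp: mpoly_ring_simps)
      then have "keys w \<subseteq> X" using keys_pushforward[of "merge j" m'] merge_X unfolding m'(2) by blast
      then have u: "keys u \<subseteq> X" by (simp add: m(2) keys_add_nat)
      have mX: "keys m \<subseteq> X" by (rule keys_sum_power[OF keys_edge_monomial m(1)])
      have mI: "single m (1 :: 'k) \<in> ?K"
        using self single_in_monomial_ideal[OF mX m(1), of 0 1] unfolding I_def by auto
      have "single m (1 :: 'k) - (single m 1 - relabel (merge j) (single m 1)) \<in> ?K"
        by (rule D(6)[OF mI diff[OF single_closed[OF mX]]])
      then have "single u c * single (pushforward (merge j) m) 1 \<in> ?K"
        by (intro D(4) single_closed u) simp
      then show ?thesis by (simp add: m(2) mult_single add.commute)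
    qed
    then have "relabel (merge j) p \<in> ?K"
      by (subst sum_single_lookup[symmetric]) (rule D(7))
    then have "(p - relabel (merge j) p) + relabel (merge j) p \<in> ?K"
      using diff[OF pR] by (intro D(3))
    then show "p \<in> ?K" by simp
  qed
qed

lemma merged_ideal_nonzerodivisor:
  fixes p :: "'k::comm_ring_1 mpoly"
  assumes j: "Suc j < d" and p: "p \<in> carrier (mpoly_ring X)"
    and fp: "(Var (Max (V (Suc j))) - Var (Min (V (Suc (Suc j))))) * p \<in> merged_ideal j k"
  shows "p \<in> merged_ideal j k"
proof -
  let ?a = "Max (V (Suc j))" and ?b = "Min (V (Suc (Suc j)))"
  have jd: "Suc (Suc j) \<in> {1..d}" "Suc j \<in> {1..d}" "Suc j \<in> {1..<d}" "j < d" using j by auto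
  have b: "merge j ?b = ?b" by (rule merge_later[OF _ jd(1) Min_V(1)[OF jd(1)]]) simp
  have "merge j ?a \<noteq> ?b"
    using merge_in_X_le[OF jd(4) Max_V_in_X[OF jd(2)]] Max_less_Min[OF jd(3)] by simp
  then have "keys (relabel (merge j) p) \<subseteq> merged_multiples j k"
  proof (rule Var_diff_nonzerodivisor)
    show "keys ((Var (merge j ?a) - Var ?b) * relabel (merge j) p) \<subseteq> merged_multiples j k"
      using fp by (simp add: merged_ideal_def b)
  qed (fact merged_multiples_up, fact merged_multiples_separated[OF j])
  then show ?thesis using p by (simp add: merged_ideal_def)
qed

lemma total_degree_merged_multiples:
  assumes "u \<in> merged_multiples j k"
  shows "d * k \<le> total_degree u"
  using assms by (auto simp: merged_multiples_def total_degree_sum_power)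

lemma single_in_merged_ideal_iff:
  assumes "keys m \<subseteq> X"
  shows "single m (1 :: 'k::comm_ring_1) \<in> merged_ideal j k \<longleftrightarrow>
    pushforward (merge j) m \<in> merged_multiples j k"
  using single_closed[OF assms, of "1 :: 'k"] by (simp add: merged_ideal_def)

lemma regular_sequence_connecting_differences:
  assumes k: "k \<ge> 1"
  shows "regular_sequence (mpoly_ring X)
    (quot_module (mpoly_ring X) (monomial_ideal X (sum_power edge_monomials k)))
    (connecting_differences :: 'k::comm_ring_1 mpoly list)"
  unfolding regular_sequence_quot_module[OF cring_mpoly_ring ideal_monomial_ideal]
proof (intro conjI allI ballI impI)
  let ?f = "connecting_differences :: 'k mpoly list"
  let ?I = "monomial_ideal X (sum_power edge_monomials k) :: 'k mpoly set"
  have take: "set (take (d - 1) ?f) = set ?f" by simp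
  have d: "d - 1 < d" using d_pos by simp
  show "set ?f \<subseteq> carrier (mpoly_ring X)"
    using connecting_difference_closed[where 'k = 'k] by (auto simp: connecting_differences_def)
  show "y \<in> genideal (mpoly_ring X) (?I \<union> set (take i ?f))"
    if i: "i < length ?f" and y: "y \<in> carrier (mpoly_ring X)"
      and fy: "?f ! i \<otimes>\<^bsub>mpoly_ring X\<^esub> y \<in> genideal (mpoly_ring X) (?I \<union> set (take i ?f))" for i y
  proof -
    have i': "i < d" "Suc i < d" "i < d - 1" using i by auto
    show ?thesis
      using fy merged_ideal_nonzerodivisor[OF i'(2) y]
      unfolding genideal_connecting_differences[OF i'(1)] nth_connecting_differences[OF i'(3)]
        mpoly_ring_simps(2) by blast
  qed
  have "single 0 (1 :: 'k) \<notin> merged_ideal (d - 1) k"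
    using total_degree_merged_multiples[of 0 "d - 1" k] k d_pos
    by (subst single_in_merged_ideal_iff) auto
  then show "\<one>\<^bsub>mpoly_ring X\<^esub> \<notin> genideal (mpoly_ring X) (?I \<union> set ?f)"
    using genideal_connecting_differences[OF d, where 'k = 'k and k = k]
    unfolding take by (simp add: mpoly_ring_simps(4))
qed

section \<open>A socle element\<close>

text \<open>Follow an edge through \<open>u\<close> below the block and an edge through \<open>v\<close> above it. As \<open>u < v\<close>, either
  vertex can be inserted in between.\<close>

lemma edge_exchange:
  assumes l: "l \<in> {1..d}" and u: "u \<in> V l" and v: "v \<in> V l" and uv: "u < v"
  obtains g where "single u 1 + g \<in> edge_monomials" "single v 1 + g \<in> edge_monomials"
proof -
  obtain p where p: "spread_path p" "p l = u" using spread_path_through[OF l u] .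
  obtain q where q: "spread_path q" "q l = v" using spread_path_through[OF l v] .
  define h where "h w i = (if i < l then p i else if i = l then w else q i)" for w i
  \<comment> \<open>The position \<open>l\<close> is left out of the sum, so any value will do for \<open>w\<close>.\<close>
  define g where "g = (\<Sum>i\<in>{1..d} - {l}. single (h 0 i) (1 :: nat))"
  have h: "spread_path (h w)" if "w \<in> V l" "u \<le> w" "w \<le> v" for w
    unfolding spread_path_def
  proof (intro conjI ballI)
    fix i assume "i \<in> {1..d}"
    then show "h w i \<in> V i" using p(1) q(1) that by (auto simp: h_def spread_path_def)
  next
    fix i assume i: "i \<in> {2..d}"
    then have "t (i - 1) \<le> int (p i) - int (p (i - 1))" "t (i - 1) \<le> int (q i) - int (q (i - 1))"
      using p(1) q(1) by (auto simp: spread_path_def)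
    then show "t (i - 1) \<le> int (h w i) - int (h w (i - 1))"
      using that p(2) q(2) i by (cases "i = l"; cases "i - 1 = l") (auto simp: h_def)
  qed
  have "path_monomial (h w) = single w 1 + g" for w
  proof -
    have "path_monomial (h w) = single (h w l) 1 + (\<Sum>i\<in>{1..d} - {l}. single (h w i) 1)"
      unfolding path_monomial_def using l by (intro sum.remove) auto
    also have "(\<Sum>i\<in>{1..d} - {l}. single (h w i) 1) = g"
      unfolding g_def by (intro sum.cong) (auto simp: h_def)
    moreover have "h w l = w" by (simp add: h_def)
    ultimately show ?thesis by (simp only:)
  qed
  then have "single w 1 + g \<in> edge_monomials" if "w \<in> V l" "u \<le> w" "w \<le> v" for w
    using h[OF that] unfolding edge_monomials_def by (metis image_eqI mem_Collect_eq)
  then show ?thesis using that[of g] u v uv by simp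
qed

definition nonminimal :: "nat set"
  where "nonminimal = X - (\<lambda>l. Min (V l)) ` {1..d}"

lemma card_nonminimal: "card nonminimal = card X - d"
proof -
  have "inj_on (\<lambda>l. Min (V l)) {1..d}"
    using V_unique Min_V(1) by (intro inj_onI) metis
  then have "card ((\<lambda>l. Min (V l)) ` {1..d}) = d" by (simp add: card_image)
  moreover have "(\<lambda>l. Min (V l)) ` {1..d} \<subseteq> X" using Min_V_in_X by blast
  ultimately show ?thesis
    unfolding nonminimal_def using finite_X by (simp add: card_Diff_subset finite_subset)
qed

text \<open>The vertices form a chain in which any two neighbours either lie in the same block, and are then
  exchangeable in an edge, or are identified by \<open>merge\<close>.\<close>

lemma predecessor_vertex:
  assumes x: "x \<in> X" "x \<noteq> Min X"
  obtains y where "y \<in> X" "y < x" "\<And>z. z \<in> X \<Longrightarrow> z < x \<Longrightarrow> z \<le> y"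
    "x \<in> nonminimal \<and> (\<exists>l\<in>{1..d}. x \<in> V l \<and> y \<in> V l) \<or>
      x \<notin> nonminimal \<and> merge (d - 1) x = merge (d - 1) y"
proof -
  have "Min X < x" using x finite_X by (simp add: le_neq_trans)
  moreover have "Min X \<in> X" using x finite_X by (intro Min_in) auto
  ultimately have ne: "{z \<in> X. z < x} \<noteq> {}" by blast
  have fin: "finite {z \<in> X. z < x}" using finite_X by simp
  define y where "y = Max {z \<in> X. z < x}"
  have y: "y \<in> X" "y < x" using Max_in[OF fin ne] by (auto simp: y_def)
  have max: "z \<le> y" if "z \<in> X" "z < x" for z using Max_ge[OF fin] that by (simp add: y_def)
  obtain l where l: "l \<in> {1..d}" "x \<in> V l" using X_block[OF x(1)] .
  obtain i where i: "i \<in> {1..d}" "y \<in> V i" using X_block[OF y(1)] .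
  have "x \<in> nonminimal \<and> (\<exists>l\<in>{1..d}. x \<in> V l \<and> y \<in> V l) \<or>
      x \<notin> nonminimal \<and> merge (d - 1) x = merge (d - 1) y"
  proof (cases "x \<in> nonminimal")
    case True
    then have "x \<noteq> Min (V l)" using l(1) by (auto simp: nonminimal_def)
    then have "Min (V l) < x" using Min_V(2)[OF l] by simp
    then have "Min (V l) \<le> y" using max Min_V_in_X[OF l(1)] by blast
    then have "\<not> i < l" using V_less[OF i(1) l(1) _ i(2) Min_V(1)[OF l(1)]] by auto
    moreover have "\<not> l < i" using V_less[OF l(1) i(1) _ l(2) i(2)] y(2) by auto
    ultimately have "i = l" by simp
    then show ?thesis using True l i by blast
  next
    case False
    then obtain l' where l': "l' \<in> {1..d}" "x = Min (V l')" using x(1) by (auto simp: nonminimal_def)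
    have "l' \<noteq> 1"
    proof
      assume "l' = 1"
      have "x \<le> z" if z: "z \<in> X" for z
      proof -
        obtain j where j: "j \<in> {1..d}" "z \<in> V j" using X_block[OF z] .
        show ?thesis
        proof (cases "j = 1")
          case True
          then show ?thesis using Min_V(2) j l' \<open>l' = 1\<close> by simp
        next
          case False
          then have "1 < j" using j(1) by simp
          then show ?thesis
            using V_less[OF l'(1) j(1) _ Min_V(1)[OF l'(1)] j(2)] l' \<open>l' = 1\<close> by simp
        qed
      qed
      then have "x = Min X" using x(1) finite_X by (metis Min_eqI)
      then show False using x(2) by simp
    qed
    then have l1: "l' - 1 \<in> {1..<d}" "Suc (l' - 1) = l'" "l' - 1 \<in> {1..d - 1}" "l' - 1 \<in> {1..d}"
      using l'(1) by auto
    have "y \<le> Max (V (l' - 1))" using le_Max_if_less_Min[OF l1(1) y(1)] y(2) l' l1(2) by simp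
    moreover have "Max (V (l' - 1)) \<le> y"
      using max[OF Max_V_in_X[OF l1(4)]] Max_less_Min[OF l1(1)] l' l1(2) by simp
    ultimately have "y = Max (V (l' - 1))" by simp
    then have "merge (d - 1) x = merge (d - 1) y"
      using merge_Max_eq_merge_Min[OF l1(3)] l1(2) l'(2) d_pos by simp
    then show ?thesis using False by blast
  qed
  then show ?thesis using that y max by blast
qed

text \<open>The monomial \<open>W\<close> is the product of one edge for each nonminimal \<open>q \<le> x\<close>, namely \<open>q\<close> times a cofactor
  that its predecessor completes to an edge as well. An additional factor \<open>v\<close> is carried up the chain
  of vertices: once it has reached the predecessor of \<open>q\<close>, it takes the place of \<open>q\<close> in the edge and
  releases \<open>q\<close>. What remains at the end is \<open>x\<close>, up to identifications. That \<open>W\<close> has a factor in the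
  class of \<open>x\<close> is what allows this remainder to be cancelled later; for \<open>c = 0\<close> there is none, as
  \<open>W\<close> is then the monomial 1.\<close>

lemma chain_of_exchanges:
  fixes x :: nat
  defines "c \<equiv> card {q \<in> nonminimal. q \<le> x}"
  assumes "x \<in> X"
  shows "\<exists>W\<in>sum_power edge_monomials c.
    (0 < c \<longrightarrow> (\<exists>y W'. W = single y 1 + W' \<and> merge (d - 1) y = merge (d - 1) x)) \<and>
    (\<forall>v\<in>X. v \<le> x \<longrightarrow> (\<exists>F\<in>sum_power edge_monomials c.
      pushforward (merge (d - 1)) (single v 1 + W) = pushforward (merge (d - 1)) (F + single x 1)))"
  using assms(2) unfolding c_def
proof (induction x rule: less_induct)
  case (less x)
  let ?\<rho> = "pushforward (merge (d - 1)) :: (nat \<Rightarrow>\<^sub>0 nat) \<Rightarrow> _"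
  let ?c = "\<lambda>x. card {q \<in> nonminimal. q \<le> x}"
  have fin: "finite {q \<in> nonminimal. q \<le> y}" for y using finite_X by (simp add: nonminimal_def)
  show ?case
  proof (cases "x = Min X")
    case True
    have "Min X = Min (V 1)"
    proof (rule Min_eqI[OF finite_X])
      have one: "1 \<in> {1..d}" using d_pos by simp
      show "Min (V 1) \<in> X" using Min_V_in_X[OF one] .
      fix y assume "y \<in> X"
      then obtain i where i: "i \<in> {1..d}" "y \<in> V i" by (rule X_block)
      show "Min (V 1) \<le> y"
        using V_less[OF one i(1) _ Min_V(1)[OF one] i(2)] Min_V(2)[OF one, of y] i
        by (cases "i = 1") (auto intro: less_imp_le)
    qed
    moreover have "1 \<in> {1..d}" using d_pos by simp
    ultimately have "Min X \<notin> nonminimal" unfolding nonminimal_def by blast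
    have eq: "v = x" if "v \<in> X" "v \<le> x" for v
      using Min_le[OF finite_X that(1)] that(2) True by simp
    have "{q \<in> nonminimal. q \<le> x} = {}"
      using eq \<open>Min X \<notin> nonminimal\<close> True unfolding nonminimal_def by blast
    then have c0: "?c x = 0" by (simp only: card.empty)
    show ?thesis unfolding c0 using eq by auto
  next
    case False
    obtain y where y: "y \<in> X" "y < x" "\<And>z. z \<in> X \<Longrightarrow> z < x \<Longrightarrow> z \<le> y"
      "x \<in> nonminimal \<and> (\<exists>l\<in>{1..d}. x \<in> V l \<and> y \<in> V l) \<or>
        x \<notin> nonminimal \<and> merge (d - 1) x = merge (d - 1) y"
      using predecessor_vertex[OF less.prems False] by metis
    obtain W where W: "W \<in> sum_power edge_monomials (?c y)"
      "0 < ?c y \<longrightarrow> (\<exists>z W'. W = single z 1 + W' \<and> merge (d - 1) z = merge (d - 1) y)"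
      "\<forall>v\<in>X. v \<le> y \<longrightarrow> (\<exists>F\<in>sum_power edge_monomials (?c y).
        ?\<rho> (single v 1 + W) = ?\<rho> (F + single y 1))"
      using less.IH[OF y(2,1)] by (elim bexE conjE)
    have below: "{q \<in> nonminimal. q \<le> x} = {q \<in> nonminimal. q \<le> y} \<union> ({x} \<inter> nonminimal)"
      using y(2,3) by (force simp: nonminimal_def)
    from y(4) show ?thesis
    proof
      assume *: "x \<in> nonminimal \<and> (\<exists>l\<in>{1..d}. x \<in> V l \<and> y \<in> V l)"
      then obtain l where l: "l \<in> {1..d}" "y \<in> V l" "x \<in> V l" by blast
      obtain g where g: "single y 1 + g \<in> edge_monomials" "single x 1 + g \<in> edge_monomials"
        using edge_exchange[OF l y(2)] .
      have "{q \<in> nonminimal. q \<le> x} = insert x {q \<in> nonminimal. q \<le> y}" using below * by auto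
      then have c: "?c x = Suc (?c y)" using y(2) fin by simp
      have W': "W + (single x 1 + g) \<in> sum_power edge_monomials (?c x)"
        unfolding c using W(1) g(2) by auto
      have "\<exists>F\<in>sum_power edge_monomials (?c x).
          ?\<rho> (single v 1 + (W + (single x 1 + g))) = ?\<rho> (F + single x 1)"
        if v: "v \<in> X" "v \<le> x" for v
      proof (cases "v = x")
        case True
        then show ?thesis using W' by (intro bexI[of _ "W + (single x 1 + g)"]) (simp add: ac_simps)
      next
        case False
        then obtain F where F: "F \<in> sum_power edge_monomials (?c y)"
          "?\<rho> (single v 1 + W) = ?\<rho> (F + single y 1)"
          using W(3)[rule_format, OF v(1)] y(3)[OF v(1)] v(2) by auto
        have "?\<rho> (single v 1 + (W + (single x 1 + g))) = ?\<rho> (single v 1 + W) + ?\<rho> (single x 1 + g)"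
          by (simp only: pushforward_add[symmetric] add.assoc)
        also have "\<dots> = ?\<rho> ((F + (single y 1 + g)) + single x 1)"
          unfolding F(2) pushforward_add[symmetric] by (simp only: ac_simps)
        finally have "?\<rho> (single v 1 + (W + (single x 1 + g))) = ?\<rho> ((F + (single y 1 + g)) + single x 1)" .
        moreover have "F + (single y 1 + g) \<in> sum_power edge_monomials (?c x)"
          unfolding c using F(1) g(1) by auto
        ultimately show ?thesis by blast
      qed
      moreover have "W + (single x 1 + g) = single x 1 + (W + g)" by (simp only: add.left_commute)
      ultimately show ?thesis using W' by blast
    next
      assume *: "x \<notin> nonminimal \<and> merge (d - 1) x = merge (d - 1) y"
      then have c: "?c x = ?c y" using below by simp
      have \<rho>_eq: "?\<rho> (F + single x 1) = ?\<rho> (F + single y 1)" for F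
        using * by (simp add: pushforward_add)
      have "\<exists>F\<in>sum_power edge_monomials (?c y). ?\<rho> (single v 1 + W) = ?\<rho> (F + single x 1)"
        if v: "v \<in> X" "v \<le> x" for v
      proof (cases "v = x")
        case True
        then have "?\<rho> (single v 1 + W) = ?\<rho> (single y 1 + W)" using * by (simp add: pushforward_add)
        then show ?thesis using W(3)[rule_format, OF y(1) order_refl] \<rho>_eq by simp
      next
        case False
        then show ?thesis using W(3)[rule_format, OF v(1)] y(3)[OF v(1)] v(2) \<rho>_eq by simp
      qed
      moreover have "0 < ?c y \<longrightarrow> (\<exists>z W'. W = single z 1 + W' \<and> merge (d - 1) z = merge (d - 1) x)"
        using W(2) * by simp
      ultimately show ?thesis unfolding c
        by (intro bexI[OF _ W(1)] conjI) blast+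
    qed
  qed
qed

text \<open>Let \<open>W\<close> be the monomial of the chain of exchanges that ends at the last vertex, multiplied by copies
  of an edge through that vertex until it is a product of \<open>k\<close> edges. Multiplied by any variable, \<open>W\<close>
  becomes a product of \<open>k\<close> edges times the last variable, up to identifications. Cancelling the last
  variable in \<open>W\<close> gives \<open>w\<close>, whose degree \<open>d k - 1\<close> is too small for a multiple of \<open>k\<close> edges. The number
  of exchanges is the number of nonminimal vertices, which is where the bound \<open>card X - d\<close> comes from.\<close>

lemma socle_monomial:
  assumes k: "1 \<le> k" "card X - d \<le> k"
  obtains w where "keys w \<subseteq> X" "total_degree w < d * k"
    "\<And>v. v \<in> X \<Longrightarrow> pushforward (merge (d - 1)) (single v 1 + w) \<in> merged_multiples (d - 1) k"
proof -
  let ?\<rho> = "pushforward (merge (d - 1)) :: (nat \<Rightarrow>\<^sub>0 nat) \<Rightarrow> _"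
  have one: "1 \<in> {1..d}" using d_pos by simp
  have "X \<noteq> {}" using Min_V_in_X[OF one] by blast
  define x where "x = Max X"
  have x: "x \<in> X" "\<And>v. v \<in> X \<Longrightarrow> v \<le> x" using finite_X \<open>X \<noteq> {}\<close> by (auto simp: x_def)
  define c where "c = card X - d"
  have "{q \<in> nonminimal. q \<le> x} = nonminimal" using x(2) by (auto simp: nonminimal_def)
  then have c: "card {q \<in> nonminimal. q \<le> x} = c" by (simp add: card_nonminimal c_def)
  obtain W where W: "W \<in> sum_power edge_monomials c"
    "0 < c \<longrightarrow> (\<exists>y W'. W = single y 1 + W' \<and> merge (d - 1) y = merge (d - 1) x)"
    "\<And>v. v \<in> X \<Longrightarrow> \<exists>F\<in>sum_power edge_monomials c. ?\<rho> (single v 1 + W) = ?\<rho> (F + single x 1)"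
    using chain_of_exchanges[OF x(1), unfolded c] x(2) by blast
  define good where "good j \<longleftrightarrow> (\<exists>W\<in>sum_power edge_monomials j.
    (0 < j \<longrightarrow> (\<exists>y W'. W = single y 1 + W' \<and> merge (d - 1) y = merge (d - 1) x)) \<and>
    (\<forall>v\<in>X. \<exists>F\<in>sum_power edge_monomials j. ?\<rho> (single v 1 + W) = ?\<rho> (F + single x 1)))" for j
  obtain l where l: "l \<in> {1..d}" "x \<in> V l" using X_block[OF x(1)] .
  obtain p where p: "spread_path p" "p l = x" using spread_path_through[OF l] .
  have e: "path_monomial p \<in> edge_monomials" using p(1) by (simp add: edge_monomials_def)
  have e_x: "path_monomial p = single x 1 + (\<Sum>i\<in>{1..d} - {l}. single (p i) 1)"
    unfolding path_monomial_def using l(1) p(2) by (subst sum.remove[of _ l]) auto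
  have good_Suc: "good (Suc j)" if "good j" for j
  proof -
    obtain W where W: "W \<in> sum_power edge_monomials j"
      "\<And>v. v \<in> X \<Longrightarrow> \<exists>F\<in>sum_power edge_monomials j. ?\<rho> (single v 1 + W) = ?\<rho> (F + single x 1)"
      using \<open>good j\<close> unfolding good_def by blast
    have "\<exists>F\<in>sum_power edge_monomials (Suc j).
        ?\<rho> (single v 1 + (W + path_monomial p)) = ?\<rho> (F + single x 1)" if v: "v \<in> X" for v
    proof -
      obtain F where F: "F \<in> sum_power edge_monomials j" "?\<rho> (single v 1 + W) = ?\<rho> (F + single x 1)"
        using W(2)[OF v] by blast
      have "?\<rho> (single v 1 + (W + path_monomial p)) = ?\<rho> (single v 1 + W) + ?\<rho> (path_monomial p)"
        by (simp only: pushforward_add[symmetric] add.assoc)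
      also have "\<dots> = ?\<rho> ((F + path_monomial p) + single x 1)"
        unfolding F(2) pushforward_add[symmetric] by (simp only: ac_simps)
      finally have "?\<rho> (single v 1 + (W + path_monomial p)) = ?\<rho> ((F + path_monomial p) + single x 1)" .
      moreover have "F + path_monomial p \<in> sum_power edge_monomials (Suc j)" using F(1) e by auto
      ultimately show ?thesis by blast
    qed
    moreover have "W + path_monomial p = single x 1 + (W + (\<Sum>i\<in>{1..d} - {l}. single (p i) 1))"
      unfolding e_x by (simp only: add.left_commute)
    moreover have "W + path_monomial p \<in> sum_power edge_monomials (Suc j)" using W(1) e by auto
    ultimately show ?thesis unfolding good_def by blast
  qed
  have "c \<le> k" using k(2) by (simp add: c_def)
  moreover have "good c" unfolding good_def using W by blast
  ultimately have "good k" by (rule dec_induct) (rule good_Suc)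
  then obtain W' where W': "W' \<in> sum_power edge_monomials k"
    "0 < k \<longrightarrow> (\<exists>y w. W' = single y 1 + w \<and> merge (d - 1) y = merge (d - 1) x)"
    "\<forall>v\<in>X. \<exists>F\<in>sum_power edge_monomials k. ?\<rho> (single v 1 + W') = ?\<rho> (F + single x 1)"
    unfolding good_def by (elim bexE conjE)
  obtain y w where w: "W' = single y 1 + w" "merge (d - 1) y = merge (d - 1) x"
    using W'(2) k(1) by auto
  show ?thesis
  proof (rule that)
    show "keys w \<subseteq> X" using keys_sum_power[OF keys_edge_monomial W'(1)] by (simp add: w(1) keys_add_nat)
    show "total_degree w < d * k" using total_degree_sum_power[OF W'(1)] by (simp add: w(1))
    fix v assume "v \<in> X"
    then obtain F where F: "F \<in> sum_power edge_monomials k"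
      "?\<rho> (single v 1 + W') = ?\<rho> (F + single x 1)" using W'(3) by blast
    have "?\<rho> (single v 1 + w) + single (merge (d - 1) x) 1 = ?\<rho> (single v 1 + W')"
      using w(2) by (simp add: w(1) pushforward_add ac_simps)
    also have "\<dots> = ?\<rho> F + single (merge (d - 1) x) 1" unfolding F(2) by (simp add: pushforward_add)
    finally have "?\<rho> (single v 1 + w) = ?\<rho> F + 0" by simp
    then show "?\<rho> (single v 1 + w) \<in> merged_multiples (d - 1) k"
      unfolding merged_multiples_def using F(1) by blast
  qed
qed

lemma depth_power_edge_ideal:
  assumes k: "1 \<le> k" "card X - d \<le> k"
  shows "depth_power (mpoly_ring X :: 'k::comm_ring_1 mpoly ring) (irrelevant_ideal X)
    (edge_ideal X (spread_edges d t V)) k = enat (d - 1)"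
proof -
  let ?R = "mpoly_ring X :: 'k mpoly ring"
  let ?f = "connecting_differences :: 'k mpoly list"
  let ?I = "monomial_ideal X (sum_power edge_monomials k) :: 'k mpoly set"
  interpret R: cring ?R by (rule cring_mpoly_ring)
  interpret A: subring_set "carrier ?R" by (rule subring_set_mpoly_ring)
  have d: "d - 1 < d" using d_pos by simp
  have chain: "genideal ?R (?I \<union> set ?f) = merged_ideal (d - 1) k"
    using genideal_connecting_differences[OF d, where 'k = 'k and k = k] by simp
  obtain w where w: "keys w \<subseteq> X" "total_degree w < d * k"
    "\<And>v. v \<in> X \<Longrightarrow> pushforward (merge (d - 1)) (single v 1 + w) \<in> merged_multiples (d - 1) k"
    using socle_monomial[OF k] by blast
  have "depth ?R (irrelevant_ideal X) (quot_module ?R ?I) = enat (length ?f)"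
  proof (rule depth_quot_module_eq[OF finite_X ideal_monomial_ideal])
    show "regular_sequence ?R (quot_module ?R ?I) ?f"
      by (rule regular_sequence_connecting_differences[OF k(1)])
    have "(Var ` X :: 'k mpoly set) \<subseteq> carrier ?R" using Var_closed by blast
    note irr = R.genideal_ideal[OF this] R.genideal_self[OF this]
    note D = A.ideal_setD[OF irr(1)[unfolded ideal_mpoly_ring_iff]]
    have "Var (Max (V l)) - Var (Min (V (Suc l))) \<in> (irrelevant_ideal X :: 'k mpoly set)"
      if "l \<in> {1..<d}" for l
      unfolding irrelevant_ideal_def using irr(2) that Max_V_in_X[of l] Min_V_in_X[of "Suc l"]
      by (intro D(6)) auto
    then show "set ?f \<subseteq> irrelevant_ideal X" by (auto simp: connecting_differences_def)
    show "single w 1 \<in> carrier ?R" by (rule single_closed[OF w(1)])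
    show "single w 1 \<notin> genideal ?R (?I \<union> set ?f)"
      unfolding chain single_in_merged_ideal_iff[OF w(1)]
      using total_degree_merged_multiples[of "pushforward (merge (d - 1)) w" "d - 1" k] w(2) by auto
    fix v assume v: "v \<in> X"
    have "Var v * single w 1 = (single (single v 1 + w) 1 :: 'k mpoly)"
      by (simp add: Var_def mult_single)
    moreover have "keys (single v 1 + w) \<subseteq> X" using v w(1) by (simp add: keys_add_nat)
    ultimately show "Var v * single w 1 \<in> genideal ?R (?I \<union> set ?f)"
      unfolding chain using w(3)[OF v] by (simp only: single_in_merged_ideal_iff)
  qed
  then show ?thesis
    unfolding depth_power_def edge_ideal_eq
    by (subst monomial_ideal_power[OF keys_edge_monomial]) simp_all
qed

end

theorem theorem3p11:
  fixes n d r :: nat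
    and t :: "nat \<Rightarrow> int"
    and V :: "nat \<Rightarrow> nat set"
    and S :: "'k::field mpoly ring"
    and \<mm> I :: "'k mpoly set"
  assumes "complete_spread_hypergraph n d t V"
    and "card (spread_vertices d V) = r"
    and "S = mpoly_ring (spread_vertices d V)"
    and "\<mm> = irrelevant_ideal (spread_vertices d V)"
    and "I = edge_ideal (spread_vertices d V) (spread_edges d t V)"
  shows "(\<lambda>k. depth_power S \<mm> I k) \<longlonglongrightarrow> enat (d - 1)
       \<and> (d < r \<longrightarrow> dstab S \<mm> I \<le> r - d)"
proof
  interpret spread_hypergraph n d t V by unfold_locales (rule assms(1))
  have depth: "depth_power S \<mm> I k = enat (d - 1)" if "1 \<le> k" "r - d \<le> k" for k
    using depth_power_edge_ideal[of k, where 'k = 'k] that assms(2) unfolding assms(3-5) by simp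
  show "(\<lambda>k. depth_power S \<mm> I k) \<longlonglongrightarrow> enat (d - 1)"
  proof (rule tendsto_eventually)
    have "\<forall>\<^sub>F k in sequentially. max 1 (r - d) \<le> k" by (rule eventually_ge_at_top)
    then show "\<forall>\<^sub>F k in sequentially. depth_power S \<mm> I k = enat (d - 1)"
      by eventually_elim (rule depth, auto)
  qed
  show "d < r \<longrightarrow> dstab S \<mm> I \<le> r - d"
  proof
    assume "d < r"
    then show "dstab S \<mm> I \<le> r - d"
      unfolding dstab_def by (intro Least_le) (auto simp: depth)
  qed
qed

end
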